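(* Suppose that $\alpha(S)<1$, where $$\alpha(S):=\frac{\sqrt2\,\theta(S,s)+\sqrt{(1+\delta_s)\,\theta(S,s)}}{\phi(S,2s)\,\Lambda(S,s)}.$$ Then the weak $(S,2s)$-irrepresentable condition holds, i.e., for all $\tau_S\in\{-1,1\}^s$ there exist an index set $\mathcal N\supset S$ with $|\mathcal N|\le 2s$ and $\Sigma_{1,1}(\mathcal N)$ non-singular, and a vector $\tau_{\mathcal N\setminus S}\in\{-1,1\}^{|\mathcal N\setminus S|}$, such that the vector $\tau_{\mathcal N}$ composed of $\tau_S$ and $\tau_{\mathcal N\setminus S}$ satisfies $$\|\Sigma_{2,1}(\mathcal N)\Sigma_{1,1}^{-1}(\mathcal N)\tau_{\mathcal N}\|_\infty\le 1.$$
   Context: $Q$ is a probability measure on a measurable space, $\psi_1,\dots,\psi_p\in L_2(Q)$ are real functions, $(\cdot,\cdot)$ and $\|\cdot\|$ are the inner product and norm of $L_2(Q)$, and $f_\beta:=\sum_{j=1}^p\beta_j\psi_j$ for $\beta\in\mathbb{R}^p$. The Gram matrix is $\Sigma=(\sigma_{j,k})$, $\sigma_{j,k}:=(\psi_j,\psi_k)$. $S\subset\{1,\dots,p\}$ is a nonempty index set, $s:=|S|$. For $\beta\in\mathbb{R}^p$ and an index set $\mathcal{N}$, $\beta_{\mathcal N}$ is the vector with entries $\beta_j1\{j\in\mathcal N\}$. $\Sigma_{1,1}(\mathcal N):=(\sigma_{j,k})_{j,k\in\mathcal N}$, $\Sigma_{2,1}(\mathcal N):=(\sigma_{j,k})_{j\notin\mathcal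 N,k\in\mathcal N}$. $\Lambda(S,s)>0$ is defined by: $\Lambda^2(S,s)$ is the smallest eigenvalue of $\Sigma_{1,1}(S)$; standing assumption: it is strictly positive. The norm $\|\cdot\|_\infty$ of an empty vector is $0$. For $\mathcal N\supset S$ let $\mathcal R(S,\mathcal N)$ be the set of $\beta\in\mathbb{R}^p$ with $\|\beta_{S^c}\|_1\le\|\beta_S\|_1\ne0$ and, if $\mathcal N\ne S$, $\|\beta_{\mathcal N^c}\|_\infty\le\min_{j\in\mathcal N\setminus S}|\beta_j|$ (no second condition if $\mathcal N=S$). The restricted eigenvalue $\phi(S,2s)\ge0$ is $$\phi^2(S,2s):=\inf\left\{\frac{\|f_\beta\|^2}{\|\beta_{\mathcal N}\|_2^2}:\ \mathcal N\supset S,\ |\mathcal N|\le2s,\ \beta\in\mathcal R(S,\mathcal N)\right\}.$$ If $\phi(S,2s)=0$, then $\alpha(S)$ is regarded as $+\infty$. The restricted orthogonality constant $\theta(S,s)$ is the supremum of $|(f_{\beta_S},f_{\beta_{\mathcal M}})|/(\|\beta_S\|_2\|\beta_{\mathcal M}\|_2)$ over all $\mathcal M\subset S^c$ with $|\mathcal M|\le s$ and all $\beta$ with $\beta_S\ne0$, $\beta_{\mathcal M}\ne0$. The restricted isometry constant $\delta_s$ is the smallest value such that $(1-\delta_s)\|\beta_{\mathcal N}\|_2^2\le\|f_{\beta_{\mathcal N}}\|^2\le(1+\delta_s)\|\beta_{\mathcal N}\|_2^2$ for all $\beta$ and all $\mathcal N\subset\{1,\dots,p\}$ with $|\mathcal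 N|\le s$. *)

theory Defs
  imports
    "HOL-Probability.Probability"
    "Jordan_Normal_Form.DL_Submatrix"
    "Jordan_Normal_Form.Gauss_Jordan_Elimination"
    "Jordan_Normal_Form.Spectral_Radius"
begin

unbundle no vec_syntax

hide_const (open) Finite_Cartesian_Product.vec Finite_Cartesian_Product.mat
hide_type (open) Finite_Cartesian_Product.vec

text \<open>
  Index sets are subsets of \<open>{..<p}\<close>, i.e. the indices \<open>1, \<dots>, p\<close> are shifted to
  \<open>0, \<dots>, p - 1\<close>, so that they agree with the row and column indices of matrices.
  Elements of $L_2(Q)$ are represented by square-integrable functions.
\<close>

definition in_L2 :: "'a measure \<Rightarrow> ('a \<Rightarrow> real) \<Rightarrow> bool" where
  "in_L2 Q f \<longleftrightarrow> f \<in> borel_measurable Q \<and> integrable Q (\<lambda>x. (f x)\<^sup>2)"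

definition L2_inner :: "'a measure \<Rightarrow> ('a \<Rightarrow> real) \<Rightarrow> ('a \<Rightarrow> real) \<Rightarrow> real" where
  "L2_inner Q f g = (\<integral>x. f x * g x \<partial>Q)"

definition L2_norm :: "'a measure \<Rightarrow> ('a \<Rightarrow> real) \<Rightarrow> real" where
  "L2_norm Q f = sqrt (L2_inner Q f f)"

definition lin_fun :: "(nat \<Rightarrow> 'a \<Rightarrow> real) \<Rightarrow> real vec \<Rightarrow> 'a \<Rightarrow> real" where
  "lin_fun \<psi> \<beta> x = (\<Sum>j<dim_vec \<beta>. \<beta> $ j * \<psi> j x)"

definition gram_mat :: "'a measure \<Rightarrow> nat \<Rightarrow> (nat \<Rightarrow> 'a \<Rightarrow> real) \<Rightarrow> real mat" where
  "gram_mat Q p \<psi> = mat p p (\<lambda>(j, k). L2_inner Q (\<psi> j) (\<psi> k))"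

definition l1_norm :: "real vec \<Rightarrow> real" where
  "l1_norm v = (\<Sum>j<dim_vec v. \<bar>v $ j\<bar>)"

definition l2_norm :: "real vec \<Rightarrow> real" where
  "l2_norm v = sqrt (\<Sum>j<dim_vec v. (v $ j)\<^sup>2)"

text \<open>The inserted \<open>0\<close> only matters for the empty vector, whose norm is \<open>0\<close>.\<close>

definition linf_norm :: "real vec \<Rightarrow> real" where
  "linf_norm v = Max (insert 0 ((\<lambda>j. \<bar>v $ j\<bar>) ` {..<dim_vec v}))"

text \<open>\<open>restr_vec N \<beta>\<close> is $\beta_N$: same dimension, entries outside \<open>N\<close> replaced by \<open>0\<close>.\<close>

definition restr_vec :: "nat set \<Rightarrow> real vec \<Rightarrow> real vec" where
  "restr_vec N \<beta> = vec (dim_vec \<beta>) (\<lambda>j. if j \<in> N then \<beta> $ j else 0)"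

text \<open>
  \<open>sub_vec N \<tau>\<close> is the vector of dimension \<open>card N\<close> with entries \<open>\<tau> j\<close>, \<open>j \<in> N\<close>,
  enumerated in increasing order of \<open>j\<close>, as the rows and columns of \<^const>\<open>submatrix\<close> are.
\<close>

definition sub_vec :: "nat set \<Rightarrow> (nat \<Rightarrow> real) \<Rightarrow> real vec" where
  "sub_vec N \<tau> = vec (card N) (\<lambda>i. \<tau> (pick N i))"

definition block11 :: "real mat \<Rightarrow> nat set \<Rightarrow> real mat" where
  "block11 \<Sigma> N = submatrix \<Sigma> N N"

definition block21 :: "real mat \<Rightarrow> nat set \<Rightarrow> real mat" where
  "block21 \<Sigma> N = submatrix \<Sigma> ({..<dim_row \<Sigma>} - N) N"

text \<open>
  Used for symmetric real matrices, all of whose complex eigenvalues belong to the real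
  spectrum; the spectrum is then finite and, in positive dimension, nonempty.
\<close>

definition min_eigenvalue :: "real mat \<Rightarrow> real" where
  "min_eigenvalue A = Min (spectrum A)"

definition Lambda_min :: "'a measure \<Rightarrow> nat \<Rightarrow> (nat \<Rightarrow> 'a \<Rightarrow> real) \<Rightarrow> nat set \<Rightarrow> real" where
  "Lambda_min Q p \<psi> S = sqrt (min_eigenvalue (block11 (gram_mat Q p \<psi>) S))"

definition restricted_set :: "nat \<Rightarrow> nat set \<Rightarrow> nat set \<Rightarrow> real vec set" where
  "restricted_set p S N =
     {\<beta> \<in> carrier_vec p.
        l1_norm (restr_vec (- S) \<beta>) \<le> l1_norm (restr_vec S \<beta>) \<and>
        l1_norm (restr_vec S \<beta>) \<noteq> 0 \<and>
        (N \<noteq> S \<longrightarrow> linf_norm (restr_vec (- N) \<beta>) \<le> (MIN j\<in>N - S. \<bar>\<beta> $ j\<bar>))}"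

definition restricted_eigenvalue ::
  "'a measure \<Rightarrow> nat \<Rightarrow> (nat \<Rightarrow> 'a \<Rightarrow> real) \<Rightarrow> nat set \<Rightarrow> nat \<Rightarrow> real" where
  "restricted_eigenvalue Q p \<psi> S L =
     sqrt (Inf {(L2_norm Q (lin_fun \<psi> \<beta>))\<^sup>2 / (l2_norm (restr_vec N \<beta>))\<^sup>2 | N \<beta>.
                  S \<subseteq> N \<and> N \<subseteq> {..<p} \<and> card N \<le> L \<and> \<beta> \<in> restricted_set p S N})"

text \<open>
  The inserted \<open>0\<close> fixes the supremum to be \<open>0\<close> (all ratios are nonnegative) when there are no
  admissible \<open>M\<close> and \<open>\<beta>\<close>, which happens exactly if \<open>S = {..<p}\<close> (for nonempty \<open>S \<subseteq> {..<p}\<close> and \<open>s > 0\<close>).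
\<close>

definition restricted_orthogonality ::
  "'a measure \<Rightarrow> nat \<Rightarrow> (nat \<Rightarrow> 'a \<Rightarrow> real) \<Rightarrow> nat set \<Rightarrow> nat \<Rightarrow> real" where
  "restricted_orthogonality Q p \<psi> S s =
     Sup (insert 0
       {\<bar>L2_inner Q (lin_fun \<psi> (restr_vec S \<beta>)) (lin_fun \<psi> (restr_vec M \<beta>))\<bar>
          / (l2_norm (restr_vec S \<beta>) * l2_norm (restr_vec M \<beta>)) | M \<beta>.
        M \<subseteq> {..<p} - S \<and> card M \<le> s \<and> \<beta> \<in> carrier_vec p \<and>
        restr_vec S \<beta> \<noteq> 0\<^sub>v p \<and> restr_vec M \<beta> \<noteq> 0\<^sub>v p})"

definition restricted_isometry ::
  "'a measure \<Rightarrow> nat \<Rightarrow> (nat \<Rightarrow> 'a \<Rightarrow> real) \<Rightarrow> nat \<Rightarrow> real" where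
  "restricted_isometry Q p \<psi> s =
     (LEAST \<delta>. \<forall>\<beta>\<in>carrier_vec p. \<forall>N. N \<subseteq> {..<p} \<and> card N \<le> s \<longrightarrow>
        (1 - \<delta>) * (l2_norm (restr_vec N \<beta>))\<^sup>2 \<le> (L2_norm Q (lin_fun \<psi> (restr_vec N \<beta>)))\<^sup>2 \<and>
        (L2_norm Q (lin_fun \<psi> (restr_vec N \<beta>)))\<^sup>2 \<le> (1 + \<delta>) * (l2_norm (restr_vec N \<beta>))\<^sup>2)"

text \<open>
  Extended-real valued because \<open>\<alpha>(S) = \<infinity>\<close> if \<open>\<phi>(S, 2s) = 0\<close>, whatever the numerator is.
\<close>

definition alpha ::
  "'a measure \<Rightarrow> nat \<Rightarrow> (nat \<Rightarrow> 'a \<Rightarrow> real) \<Rightarrow> nat set \<Rightarrow> ereal" where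
  "alpha Q p \<psi> S =
     (let s = card S;
          \<theta> = restricted_orthogonality Q p \<psi> S s;
          \<delta> = restricted_isometry Q p \<psi> s;
          \<phi> = restricted_eigenvalue Q p \<psi> S (2 * s)
      in if \<phi> = 0 then \<infinity>
         else ereal ((sqrt 2 * \<theta> + sqrt ((1 + \<delta>) * \<theta>)) / (\<phi> * Lambda_min Q p \<psi> S)))"

text \<open>
  The matrix products are well-dimensioned since \<^term>\<open>mat_inverse (block11 \<Sigma> N)\<close> is
  \<^term>\<open>Some\<close> of the inverse whenever \<^term>\<open>block11 \<Sigma> N\<close> is invertible. A sign vector
  indexed by a set \<open>A\<close> is an element of \<^term>\<open>A \<rightarrow>\<^sub>E {- 1, 1 :: real}\<close>.
\<close>

definition weak_irrepresentable :: "real mat \<Rightarrow> nat set \<Rightarrow> nat \<Rightarrow> bool" where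
  "weak_irrepresentable \<Sigma> S L \<longleftrightarrow>
     (\<forall>\<tau>S \<in> S \<rightarrow>\<^sub>E {- 1, 1 :: real}. \<exists>N.
        S \<subseteq> N \<and> N \<subseteq> {..<dim_row \<Sigma>} \<and> card N \<le> L \<and> invertible_mat (block11 \<Sigma> N) \<and>
        (\<exists>\<tau>' \<in> (N - S) \<rightarrow>\<^sub>E {- 1, 1 :: real}.
           linf_norm ((block21 \<Sigma> N * the (mat_inverse (block11 \<Sigma> N))) *\<^sub>v
             sub_vec N (\<lambda>j. if j \<in> S then \<tau>S j else \<tau>' j)) \<le> 1))"

end

(* Fix signs tau on S and minimise the Lasso-type objective
     F u = |f_u|^2 / 2 + sum_{i in S} tau_i u_i + sum_{i notin S} |u_i|.
   A minimiser u exists since phi > 0, and its stationarity conditions say that Sigma u = - tau_N on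
   N = S + supp u, where tau_N extends tau by the signs of u, and |Sigma u| <= 1 off N. Hence
   Sigma_21 Sigma_11^-1 tau_N = - Sigma_21 u_N is bounded by 1, as soon as Sigma_11(N) is invertible,
   which holds for a minimiser of least support: along a null vector F is constant until an entry of u
   outside S vanishes.

   To bound the number of active indices outside S, compare u with the minimiser b among the vectors
   supported in S, for which |b|_2 <= sqrt s / Lambda^2. Cutting u_{S^c} into blocks of decreasing
   entries gives |f_u - f_b|^2 <= theta s / (Lambda phi)^2. If M consists of s active indices outside S,
   then s = - (f_{sgn u_M}, f_u) <= s theta / Lambda^2 + s sqrt ((1 + delta) theta) / (Lambda phi) < s. *)

theory Submission
  imports Defs
begin

section \<open>Penalised minimisation of a quadratic form\<close>

text \<open>The form is bounded below only on the cone of the restricted eigenvalue, so the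
  objective may fail to be coercive and to have a unique minimiser. Existence survives because a
  vector \<open>w\<close> whose objective is at most 0, the value at the origin, satisfies
  \<open>form w w / 2\<close> + |w_{S^c}|_1 \<le> |w_S|_1 and so lies in the cone.

  In the comparison with b, stationarity on S cancels the part of |f_{u-b}|^2 carried by S; what
  remains is -|u_{S^c}|_1 - (f_b, f_{u_{S^c}}). All blocks after the first together contribute at
  most (theta |b|_2 / sqrt s) |u_{S^c}|_1, which the penalty absorbs since theta \<le> phi Lambda
  \<le> Lambda^2. The first block joined to S has at most 2s indices and dominates all other
  entries, which is exactly what phi(S,2s) asks for, so |u|_2 on this set is at most sqrt s / phi^2.
  Multiplying theta by the two norm bounds gives theta s / (Lambda phi)^2. The inequality phi \<le>
  Lambda, obtained by testing phi with a lowest eigenvector, also brings s theta / Lambda^2 to the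
  denominator Lambda phi of alpha(S).\<close>

locale psd_form =
  fixes I :: "'i set" and \<sigma> :: "'i \<Rightarrow> 'i \<Rightarrow> real"
  assumes finite_I: "finite I"
    and sym: "\<And>i j. i \<in> I \<Longrightarrow> j \<in> I \<Longrightarrow> \<sigma> i j = \<sigma> j i"
    and psd: "\<And>u. 0 \<le> (\<Sum>i\<in>I. u i * (\<Sum>j\<in>I. \<sigma> i j * u j))"
begin

definition grad :: "('i \<Rightarrow> real) \<Rightarrow> 'i \<Rightarrow> real" where
  "grad u i = (\<Sum>j\<in>I. \<sigma> i j * u j)"

definition form :: "('i \<Rightarrow> real) \<Rightarrow> ('i \<Rightarrow> real) \<Rightarrow> real" where
  "form u v = (\<Sum>i\<in>I. u i * grad v i)"

lemma form_nonneg: "0 \<le> form u u"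
  using psd[of u] by (simp add: form_def grad_def)

lemma form_commute: "form u v = form v u"
proof -
  have "form u v = (\<Sum>i\<in>I. \<Sum>j\<in>I. u i * (\<sigma> i j * v j))"
    by (simp add: form_def grad_def sum_distrib_left)
  also have "\<dots> = (\<Sum>j\<in>I. \<Sum>i\<in>I. u i * (\<sigma> i j * v j))"
    by (rule sum.swap)
  also have "\<dots> = (\<Sum>j\<in>I. \<Sum>i\<in>I. v j * (\<sigma> j i * u i))"
    by (intro sum.cong refl) (simp add: sym)
  also have "\<dots> = form v u"
    by (simp add: form_def grad_def sum_distrib_left)
  finally show ?thesis .
qed

lemma grad_add: "grad (\<lambda>i. u i + t * v i) i = grad u i + t * grad v i"
  by (simp add: grad_def algebra_simps sum.distrib sum_distrib_left)

lemma form_add_left: "form (\<lambda>i. u i + t * v i) w = form u w + t * form v w"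
  by (simp add: form_def algebra_simps sum.distrib sum_distrib_left)

lemma form_add_right: "form w (\<lambda>i. u i + t * v i) = form w u + t * form w v"
  using form_add_left[of u t v w] by (simp add: form_commute)

lemma form_add: "form (\<lambda>i. u i + t * v i) (\<lambda>i. u i + t * v i) = form u u + 2 * t * form v u + t\<^sup>2 * form v v"
  by (simp add: form_add_left form_add_right form_commute[of u v] power2_eq_square algebra_simps)

text \<open>The discriminant argument, run for a form that is only semidefinite. The degenerate case
  \<open>form v v = 0\<close> matters later: it says that a null vector is orthogonal to every
  vector.\<close>

lemma Cauchy_Schwarz: "\<bar>form u v\<bar> \<le> sqrt (form u u) * sqrt (form v v)"
proof -
  let ?a = "form v v" and ?b = "form v u" and ?c = "form u u"
  have q: "0 \<le> ?c + 2 * t * ?b + t\<^sup>2 * ?a" for t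
    using form_nonneg[of "\<lambda>i. u i + t * v i"] unfolding form_add .
  have "?b\<^sup>2 \<le> ?a * ?c"
  proof (cases "?a = 0")
    case True
    have "?b = 0"
    proof (rule ccontr)
      assume "?b \<noteq> 0"
      \<comment> \<open>With \<open>?a = 0\<close> the quadratic is affine in \<open>t\<close>, and
        this \<open>t\<close> gives it the value -1.\<close>
      then show False
        using q[of "- (?c + 1) / (2 * ?b)"] True by (simp add: field_simps)
    qed
    then show ?thesis using True by simp
  next
    case False
    then have "?a > 0" using form_nonneg[of v] by simp
    then show ?thesis
      using q[of "- ?b / ?a"] by (simp add: field_simps power2_eq_square)
  qed
  then have "sqrt (?b\<^sup>2) \<le> sqrt (?a * ?c)" by (rule real_sqrt_le_mono)
  then show ?thesis
    by (simp add: real_sqrt_mult form_commute mult.commute)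
qed

lemma form_eq_sum_subset:
  assumes "A \<subseteq> I" "\<And>i. i \<in> I - A \<Longrightarrow> u i = 0"
  shows "form u v = (\<Sum>i\<in>A. u i * grad v i)"
  unfolding form_def using assms finite_I by (intro sum.mono_neutral_right) auto

text \<open>On \<open>S\<close> the penalty is linear instead of an absolute value, so that
  stationarity forces the prescribed gradient \<open>- \<tau> i\<close> there, whatever the sign of
  \<open>u i\<close>.\<close>

definition objective :: "'i set \<Rightarrow> ('i \<Rightarrow> real) \<Rightarrow> ('i \<Rightarrow> real) \<Rightarrow> real" where
  "objective S \<tau> u = form u u / 2 + (\<Sum>i\<in>S. \<tau> i * u i) + (\<Sum>i\<in>I - S. \<bar>u i\<bar>)"

text \<open>The set \<open>A\<close> of allowed indices is all of \<open>I\<close> for the main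
  minimiser and \<open>S\<close> for the comparison vector. Requiring zeros off \<open>A\<close>
  also fixes the values outside \<open>I\<close>, which the objective does not see.\<close>

definition minimizer :: "'i set \<Rightarrow> ('i \<Rightarrow> real) \<Rightarrow> 'i set \<Rightarrow> ('i \<Rightarrow> real) \<Rightarrow> bool" where
  "minimizer S \<tau> A u \<longleftrightarrow> (\<forall>i. i \<notin> A \<longrightarrow> u i = 0) \<and>
     (\<forall>w. (\<forall>i. i \<notin> A \<longrightarrow> w i = 0) \<longrightarrow> objective S \<tau> u \<le> objective S \<tau> w)"

lemma continuous_on_coordinate: "continuous_on K (\<lambda>u. u i :: real)"
  by (rule continuous_on_subset[OF continuous_on_product_coordinates]) simp

lemma continuous_on_form [continuous_intros]:
  "continuous_on K (\<lambda>u. form u u)"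
  unfolding form_def grad_def
  by (intro continuous_intros continuous_on_coordinate)

lemma continuous_on_objective: "continuous_on K (objective S \<tau>)"
  unfolding objective_def
  by (intro continuous_intros continuous_on_coordinate) auto

end

section \<open>Existence of minimisers and first-order conditions\<close>

text \<open>Tychonoff's theorem: the coordinates off \<open>A\<close> range over the compact set
  \<open>{0}\<close>, so the index type may be infinite.\<close>

lemma compact_box:
  fixes R :: real
  shows "compact {u. \<forall>i. (i \<in> A \<longrightarrow> \<bar>u i\<bar> \<le> R) \<and> (i \<notin> A \<longrightarrow> u i = 0)}"
proof -
  have "compactin (product_topology (\<lambda>i. euclidean) UNIV) (PiE UNIV (\<lambda>i. if i \<in> A then {-R..R} else {0 :: real}))"
    by (subst compactin_PiE) auto
  then have "compact (PiE UNIV (\<lambda>i. if i \<in> A then {-R..R} else {0 :: real}))"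
    by (simp add: euclidean_product_topology)
  also have "PiE UNIV (\<lambda>i. if i \<in> A then {-R..R} else {0 :: real}) = {u. \<forall>i. (i \<in> A \<longrightarrow> \<bar>u i\<bar> \<le> R) \<and> (i \<notin> A \<longrightarrow> u i = 0)}"
    by (force simp: PiE_def Pi_def abs_le_iff split: if_splits)
  finally show ?thesis .
qed

text \<open>A one-sided derivative test. It is stated for \<open>t\<close> in a right neighbourhood
  of 0 only, because absolute values are linear only up to the first sign change.\<close>

lemma nonneg_slope:
  fixes a c r :: real
  assumes "r > 0" "\<And>t. 0 < t \<Longrightarrow> t \<le> r \<Longrightarrow> 0 \<le> t * c + t\<^sup>2 * a"
  shows "0 \<le> c"
proof (rule ccontr)
  assume "\<not> 0 \<le> c"
  then have c: "c < 0" by simp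
  \<comment> \<open>The second argument makes \<open>t * \<bar>a\<bar>\<close> at most half of
    \<open>- c\<close>, so the quadratic term cannot compensate the negative slope.\<close>
  define t where "t = min r (- c / (2 * (\<bar>a\<bar> + 1)))"
  have t: "0 < t" "t \<le> r" using assms(1) c by (auto simp: t_def field_simps)
  have "t \<le> - c / (2 * (\<bar>a\<bar> + 1))" by (simp add: t_def)
  then have "t * (2 * (\<bar>a\<bar> + 1)) \<le> - c"
    by (subst (asm) pos_le_divide_eq) auto
  moreover have "t * a \<le> t * (\<bar>a\<bar> + 1)" using t by (intro mult_left_mono) auto
  ultimately have "c + t * a < 0" using c by (simp add: algebra_simps)
  then have "t * (c + t * a) < 0" using t by (simp add: mult_pos_neg)
  then show False using assms(2)[OF t] by (simp add: power2_eq_square algebra_simps)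
qed

context psd_form
begin

lemma minimizer_exists:
  assumes S: "S \<subseteq> I" "S \<noteq> {}" and A: "A \<subseteq> I" and \<tau>: "\<And>i. i \<in> S \<Longrightarrow> \<bar>\<tau> i\<bar> \<le> 1" and "0 < c"
    and cone: "\<And>u. (\<Sum>i\<in>I - S. \<bar>u i\<bar>) \<le> (\<Sum>i\<in>S. \<bar>u i\<bar>) \<Longrightarrow> c * (\<Sum>i\<in>S. (u i)\<^sup>2) \<le> form u u"
  shows "\<exists>u. minimizer S \<tau> A u"
proof -
  have fS: "finite S" using S finite_I finite_subset by auto
  \<comment> \<open>For \<open>x\<close> the sum of absolute values over \<open>S\<close>, the cone
    bound gives c x^2 \<le> |S| \<open>form w w\<close> and a nonpositive objective gives
    \<open>form w w\<close> \<le> 2x; together x \<le> \<open>R\<close>.\<close>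
  define R where "R = 2 * card S / c"
  define K where "K = {u. \<forall>i. (i \<in> A \<longrightarrow> \<bar>u i\<bar> \<le> R) \<and> (i \<notin> A \<longrightarrow> u i = 0)}"
  have R: "R \<ge> 0" using \<open>0 < c\<close> by (simp add: R_def)
  have z: "(\<lambda>_. 0) \<in> K" using R by (simp add: K_def)
  then have "K \<noteq> {}" by auto
  moreover have "compact K" unfolding K_def by (rule compact_box)
  ultimately have "\<exists>u\<in>K. \<forall>w\<in>K. objective S \<tau> u \<le> objective S \<tau> w"
    by (intro continuous_attains_inf continuous_on_objective)
  then obtain u where u: "u \<in> K" "\<And>w. w \<in> K \<Longrightarrow> objective S \<tau> u \<le> objective S \<tau> w"
    by blast
  have 0: "objective S \<tau> (\<lambda>_. 0) = 0" by (simp add: objective_def form_def)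
  \<comment> \<open>Outside the box the objective is positive while it is 0 at the origin, so a
    minimiser over the box is a global one.\<close>
  have out: "w \<in> K" if w0: "\<And>i. i \<notin> A \<Longrightarrow> w i = 0" and "objective S \<tau> w \<le> 0" for w
  proof -
    define x where "x = (\<Sum>i\<in>S. \<bar>w i\<bar>)"
    define y where "y = (\<Sum>i\<in>I - S. \<bar>w i\<bar>)"
    have xy: "0 \<le> x" "0 \<le> y" by (auto simp: x_def y_def intro: sum_nonneg)
    have "- (\<Sum>i\<in>S. \<tau> i * w i) \<le> x"
      unfolding x_def sum_negf[symmetric]
    proof (rule sum_mono)
      fix i assume "i \<in> S"
      have "- (\<tau> i * w i) \<le> \<bar>\<tau> i\<bar> * \<bar>w i\<bar>" by (metis abs_ge_minus_self abs_mult)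
      also have "\<dots> \<le> 1 * \<bar>w i\<bar>" using \<tau>[OF \<open>i \<in> S\<close>] by (intro mult_right_mono) auto
      finally show "- (\<tau> i * w i) \<le> \<bar>w i\<bar>" by simp
    qed
    then have main: "form w w / 2 + y \<le> x" using that(2) by (simp add: objective_def y_def)
    then have yx: "y \<le> x" using form_nonneg[of w] by simp
    then have "c * (\<Sum>i\<in>S. (w i)\<^sup>2) \<le> form w w" using cone by (simp add: x_def y_def)
    moreover have "x\<^sup>2 \<le> card S * (\<Sum>i\<in>S. (w i)\<^sup>2)"
      using Cauchy_Schwarz_ineq_sum[of "\<lambda>_. 1" "\<lambda>i. \<bar>w i\<bar>" S] by (simp add: x_def)
    then have "c * x\<^sup>2 \<le> card S * (c * (\<Sum>i\<in>S. (w i)\<^sup>2))"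
      using \<open>0 < c\<close> by (simp add: mult.left_commute)
    ultimately have "c * x\<^sup>2 \<le> card S * form w w"
      by (meson mult_left_mono of_nat_0_le_iff order_trans)
    also have "\<dots> \<le> card S * (2 * x)" using main xy by (intro mult_left_mono) auto
    finally have "c * x * x \<le> 2 * card S * x" by (simp add: power2_eq_square mult.assoc mult.left_commute)
    then have "x \<le> R" using xy \<open>0 < c\<close>
      by (cases "x = 0") (auto simp: R_def field_simps)
    moreover have "\<bar>w i\<bar> \<le> x" if "i \<in> I" for i
    proof (cases "i \<in> S")
      case True
      then show ?thesis unfolding x_def using fS by (intro member_le_sum) auto
    next
      case False
      then have "\<bar>w i\<bar> \<le> y" unfolding y_def using that finite_I by (intro member_le_sum) auto
      then show ?thesis using yx by simp
    qed
    ultimately show ?thesis using w0 A unfolding K_def by fastforce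
  qed
  have "minimizer S \<tau> A u"
    unfolding minimizer_def
  proof (intro conjI allI impI)
    fix w :: "'i \<Rightarrow> real" assume w: "\<forall>i. i \<notin> A \<longrightarrow> w i = 0"
    show "objective S \<tau> u \<le> objective S \<tau> w"
    proof (cases "objective S \<tau> w \<le> 0")
      case True
      then have "w \<in> K" using w by (intro out) auto
      then show ?thesis by (rule u(2))
    next
      case False
      then show ?thesis using u(2)[OF z] 0 by simp
    qed
  qed (use u in \<open>auto simp: K_def\<close>)
  then show ?thesis by blast
qed

text \<open>Single-coordinate moves are enough: the form is smooth and the penalty is a sum over
  coordinates, so they yield every stationarity condition used below.\<close>

lemma objective_perturb:
  assumes S: "S \<subseteq> I" and j: "j \<in> I"
  shows "objective S \<tau> (\<lambda>i. u i + t * (if i = j then 1 else 0)) =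
    objective S \<tau> u + t * grad u j + t\<^sup>2 * (\<sigma> j j / 2) + (if j \<in> S then t * \<tau> j else \<bar>u j + t\<bar> - \<bar>u j\<bar>)"
proof -
  let ?e = "\<lambda>i. if i = j then 1 else 0 :: real"
  have fS: "finite S" using S finite_I finite_subset by auto
  have g: "grad ?e i = \<sigma> i j" for i using j finite_I by (simp add: grad_def if_distrib cong: if_cong)
  have f: "form ?e v = grad v j" for v using j finite_I by (simp add: form_def if_distrib[of "\<lambda>x. x * _"] cong: if_cong)
  have "(\<Sum>i\<in>S. \<tau> i * (u i + t * ?e i)) = (\<Sum>i\<in>S. \<tau> i * u i) + (if j \<in> S then t * \<tau> j else 0)"
  proof -
    have "(\<Sum>i\<in>S. \<tau> i * (u i + t * ?e i)) = (\<Sum>i\<in>S. \<tau> i * u i + (if i = j then t * \<tau> j else 0))"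
      by (intro sum.cong) (auto simp: algebra_simps)
    then show ?thesis using fS by (simp add: sum.distrib)
  qed
  moreover have "(\<Sum>i\<in>I - S. \<bar>u i + t * ?e i\<bar>) = (\<Sum>i\<in>I - S. \<bar>u i\<bar>) + (if j \<in> S then 0 else \<bar>u j + t\<bar> - \<bar>u j\<bar>)"
  proof -
    have "(\<Sum>i\<in>I - S. \<bar>u i + t * ?e i\<bar>) = (\<Sum>i\<in>I - S. \<bar>u i\<bar> + (if i = j then \<bar>u j + t\<bar> - \<bar>u j\<bar> else 0))"
      by (intro sum.cong) auto
    then show ?thesis using finite_I j by (simp add: sum.distrib)
  qed
  ultimately show ?thesis
    unfolding objective_def form_add f g by (simp add: field_simps)
qed

lemma minimizer_perturb:
  assumes "minimizer S \<tau> A u" "S \<subseteq> I" "A \<subseteq> I" "j \<in> A"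
  shows "0 \<le> t * grad u j + t\<^sup>2 * (\<sigma> j j / 2) + (if j \<in> S then t * \<tau> j else \<bar>u j + t\<bar> - \<bar>u j\<bar>)"
proof -
  have "objective S \<tau> u \<le> objective S \<tau> (\<lambda>i. u i + t * (if i = j then 1 else 0))"
    using assms unfolding minimizer_def by auto
  then show ?thesis using assms by (subst (asm) objective_perturb) auto
qed

lemma minimizer_grad_inside:
  assumes "minimizer S \<tau> A u" "S \<subseteq> A" "A \<subseteq> I" "j \<in> S"
  shows "grad u j = - \<tau> j"
proof -
  have *: "0 \<le> t * grad u j + t\<^sup>2 * (\<sigma> j j / 2) + t * \<tau> j" for t
    using minimizer_perturb[OF assms(1) _ assms(3), of j t] assms by auto
  have "0 \<le> grad u j + \<tau> j"
    by (rule nonneg_slope[where r = 1 and a = "\<sigma> j j / 2"]) (use * in \<open>auto simp: algebra_simps\<close>)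
  moreover have "0 \<le> - (grad u j + \<tau> j)"
    by (rule nonneg_slope[where r = 1 and a = "\<sigma> j j / 2"]) (use *[of "- t" for t] in \<open>auto simp: algebra_simps\<close>)
  ultimately show ?thesis by simp
qed

text \<open>The subgradient conditions of the absolute value: its increment is at most the step
  length, which bounds the gradient, and is exactly linear near a nonzero entry, which determines
  it.\<close>

lemma minimizer_grad_outside:
  assumes "minimizer S \<tau> A u" "S \<subseteq> I" "A \<subseteq> I" "j \<in> A - S"
  shows "\<bar>grad u j\<bar> \<le> 1" and "u j \<noteq> 0 \<Longrightarrow> grad u j = - sgn (u j)"
proof -
  have *: "0 \<le> t * grad u j + t\<^sup>2 * (\<sigma> j j / 2) + (\<bar>u j + t\<bar> - \<bar>u j\<bar>)" for t
    using minimizer_perturb[OF assms(1-3), of j t] assms by auto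
  have "0 \<le> 1 + grad u j"
  proof (rule nonneg_slope[where r = 1 and a = "\<sigma> j j / 2"])
    fix t :: real assume "0 < t"
    then have "\<bar>u j + t\<bar> - \<bar>u j\<bar> \<le> t" by simp
    then show "0 \<le> t * (1 + grad u j) + t\<^sup>2 * (\<sigma> j j / 2)" using *[of t] by (simp add: algebra_simps)
  qed simp
  moreover have "0 \<le> 1 - grad u j"
  proof (rule nonneg_slope[where r = 1 and a = "\<sigma> j j / 2"])
    fix t :: real assume "0 < t"
    then have "\<bar>u j + - t\<bar> - \<bar>u j\<bar> \<le> t" by simp
    then show "0 \<le> t * (1 - grad u j) + t\<^sup>2 * (\<sigma> j j / 2)" using *[of "- t"] by (simp add: algebra_simps)
  qed simp
  ultimately show "\<bar>grad u j\<bar> \<le> 1" by simp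
  assume nz: "u j \<noteq> 0"
  have "0 \<le> sgn (u j) + grad u j"
  \<comment> \<open>Steps of length at most \<open>\<bar>u j\<bar>\<close> do not take
    \<open>u j\<close> across 0.\<close>
  proof (rule nonneg_slope[where r = "\<bar>u j\<bar>" and a = "\<sigma> j j / 2"])
    fix t :: real assume "0 < t" "t \<le> \<bar>u j\<bar>"
    then have "\<bar>u j + t\<bar> - \<bar>u j\<bar> = t * sgn (u j)" by (auto simp: sgn_if)
    then show "0 \<le> t * (sgn (u j) + grad u j) + t\<^sup>2 * (\<sigma> j j / 2)" using *[of t] by (simp add: algebra_simps)
  qed (use nz in simp)
  moreover have "0 \<le> - (sgn (u j) + grad u j)"
  proof (rule nonneg_slope[where r = "\<bar>u j\<bar>" and a = "\<sigma> j j / 2"])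
    fix t :: real assume "0 < t" "t \<le> \<bar>u j\<bar>"
    then have "\<bar>u j + - t\<bar> - \<bar>u j\<bar> = - t * sgn (u j)" by (auto simp: sgn_if)
    then show "0 \<le> t * - (sgn (u j) + grad u j) + t\<^sup>2 * (\<sigma> j j / 2)" using *[of "- t"] by (simp add: algebra_simps)
  qed (use nz in simp)
  ultimately show "grad u j = - sgn (u j)" by simp
qed

end

section \<open>Norm inequalities and decomposition into blocks\<close>

lemma sum_abs_le_L2_set: "(\<Sum>i\<in>A. \<bar>u i\<bar>) \<le> sqrt (card A) * L2_set u A"
  using L2_set_mult_ineq[of u "\<lambda>_. 1" A] by (simp add: L2_set_constant mult.commute)

lemma sum_sign_le:
  assumes "\<And>i. i \<in> S \<Longrightarrow> \<bar>\<tau> i\<bar> = 1"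
  shows "- (\<Sum>i\<in>S. \<tau> i * u i) \<le> (\<Sum>i\<in>S. \<bar>u i :: real\<bar>)"
  unfolding sum_negf[symmetric]
proof (rule sum_mono)
  fix i assume "i \<in> S"
  then have "\<bar>- (\<tau> i * u i)\<bar> = \<bar>u i\<bar>" using assms by (simp add: abs_mult)
  then show "- (\<tau> i * u i) \<le> \<bar>u i\<bar>" by linarith
qed

lemma exists_top_subset:
  fixes f :: "'i \<Rightarrow> real"
  assumes "finite T" "k \<le> card T"
  shows "\<exists>M\<subseteq>T. card M = k \<and> (\<forall>i\<in>T - M. \<forall>j\<in>M. f i \<le> f j)"
  using assms(2)
proof (induction k)
  case 0
  then show ?case by (intro exI[of _ "{}"]) auto
next
  case (Suc k)
  then obtain M where M: "M \<subseteq> T" "card M = k" "\<forall>i\<in>T - M. \<forall>j\<in>M. f i \<le> f j" by auto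
  have fM: "finite M" using M assms finite_subset by auto
  have "card (T - M) > 0" using Suc.prems M fM by (simp add: card_Diff_subset)
  then have "T - M \<noteq> {}" by (metis card.empty less_irrefl)
  then have "Max (f ` (T - M)) \<in> f ` (T - M)" using assms(1) by (intro Max_in) auto
  then obtain m where m: "m \<in> T - M" "f m = Max (f ` (T - M))" by auto
  then have m_max: "\<forall>i\<in>T - M. f i \<le> f m" using assms(1) by simp
  show ?case
    by (rule exI[of _ "insert m M"]) (use M m(1) m_max fM in auto)
qed

text \<open>The entries of each block of size \<open>s\<close> are at most the mean of the preceding block, so the
  \<open>\<ell>\<^sub>2\<close> norms of all blocks but the first sum up to at most the \<open>\<ell>\<^sub>1\<close> norm over the square root of \<open>s\<close>.\<close>

lemma sum_mult_le_block_bound: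
  fixes u g :: "'i \<Rightarrow> real"
  assumes "finite T" "0 < s" "0 \<le> K"
    and "\<And>M. M \<subseteq> T \<Longrightarrow> card M \<le> s \<Longrightarrow> \<bar>\<Sum>j\<in>M. u j * g j\<bar> \<le> K * L2_set u M"
  shows "\<exists>M\<subseteq>T. card M \<le> s \<and> (T \<noteq> {} \<longrightarrow> M \<noteq> {}) \<and> (\<forall>i\<in>T - M. \<forall>j\<in>M. \<bar>u i\<bar> \<le> \<bar>u j\<bar>) \<and>
    \<bar>\<Sum>j\<in>T. u j * g j\<bar> \<le> K * (L2_set u M + (\<Sum>j\<in>T. \<bar>u j\<bar>) / sqrt s)"
  using assms(1,4)
proof (induction T rule: finite_psubset_induct)
  case (psubset T)
  show ?case
  proof (cases "card T \<le> s")
    case True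
    have "\<bar>\<Sum>j\<in>T. u j * g j\<bar> \<le> K * L2_set u T" using psubset.prems True by blast
    also have "\<dots> \<le> K * (L2_set u T + (\<Sum>j\<in>T. \<bar>u j\<bar>) / sqrt s)"
      using assms(3) by (intro mult_left_mono) (auto intro!: divide_nonneg_nonneg sum_nonneg)
    finally show ?thesis using True by (intro exI[of _ T]) auto
  next
    case False
    then obtain M where M: "M \<subseteq> T" "card M = s" "\<forall>i\<in>T - M. \<forall>j\<in>M. \<bar>u i\<bar> \<le> \<bar>u j\<bar>"
      using exists_top_subset[OF psubset.hyps, of s "\<lambda>i. \<bar>u i\<bar>"] by auto
    have "M \<noteq> {}" using M assms(2) by auto
    have fM: "finite M" using M psubset.hyps finite_subset by auto
    have "T - M \<subset> T" using M \<open>M \<noteq> {}\<close> by auto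
    then obtain M' where M': "M' \<subseteq> T - M" "card M' \<le> s"
      "\<bar>\<Sum>j\<in>T - M. u j * g j\<bar> \<le> K * (L2_set u M' + (\<Sum>j\<in>T - M. \<bar>u j\<bar>) / sqrt s)"
      using psubset.IH[of "T - M"] psubset.prems by blast
    have fM': "finite M'" using M' psubset.hyps finite_subset by (metis finite_Diff)
    define a where "a = (\<Sum>j\<in>M. \<bar>u j\<bar>) / s"
    have a: "0 \<le> a" by (simp add: a_def sum_nonneg)
    have "\<bar>u i\<bar> \<le> a" if "i \<in> M'" for i
    proof -
      have "s * \<bar>u i\<bar> \<le> (\<Sum>j\<in>M. \<bar>u j\<bar>)"
        using sum_bounded_below[of M "\<bar>u i\<bar>" "\<lambda>j. \<bar>u j\<bar>"] M M' that by auto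
      then show ?thesis using assms(2) by (simp add: a_def field_simps)
    qed
    then have "(\<Sum>i\<in>M'. (u i)\<^sup>2) \<le> (\<Sum>i\<in>M'. a\<^sup>2)"
      by (intro sum_mono) (metis abs_ge_zero power2_abs power_mono)
    also have "\<dots> \<le> s * a\<^sup>2" using M'(2) by (simp add: mult_right_mono)
    finally have "L2_set u M' \<le> sqrt (s * a\<^sup>2)" unfolding L2_set_def by (rule real_sqrt_le_mono)
    also have "\<dots> = sqrt s * a" using a by (simp add: real_sqrt_mult)
    \<comment> \<open>The mean brings a factor 1/s and the norm of a constant block a factor sqrt s,
      whence 1 / sqrt s.\<close>
    also have "\<dots> = (\<Sum>j\<in>M. \<bar>u j\<bar>) / sqrt s"
      using assms(2) by (simp add: a_def field_simps flip: power2_eq_square)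
    finally have L: "L2_set u M' \<le> (\<Sum>j\<in>M. \<bar>u j\<bar>) / sqrt s" .
    have split: "(\<Sum>j\<in>T. h j) = (\<Sum>j\<in>M. h j) + (\<Sum>j\<in>T - M. h j)" for h :: "'i \<Rightarrow> real"
      using sum.subset_diff[OF M(1) psubset.hyps, of h] by simp
    have "\<bar>\<Sum>j\<in>T. u j * g j\<bar> \<le> K * L2_set u M + K * (L2_set u M' + (\<Sum>j\<in>T - M. \<bar>u j\<bar>) / sqrt s)"
      unfolding split[of "\<lambda>j. u j * g j"] using M'(3) psubset.prems[of M] M by auto
    also have "\<dots> \<le> K * L2_set u M + K * ((\<Sum>j\<in>M. \<bar>u j\<bar>) / sqrt s + (\<Sum>j\<in>T - M. \<bar>u j\<bar>) / sqrt s)"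
      using L assms(3) by (intro add_left_mono mult_left_mono) auto
    also have "\<dots> = K * (L2_set u M + (\<Sum>j\<in>T. \<bar>u j\<bar>) / sqrt s)"
      unfolding split[of "\<lambda>j. \<bar>u j\<bar>"] by (simp add: algebra_simps add_divide_distrib)
    finally show ?thesis using M \<open>M \<noteq> {}\<close> by (intro exI[of _ M]) auto
  qed
qed

section \<open>Sparse minimisers and the number of active indices\<close>

context psd_form
begin

text \<open>The last clause is injectivity of the Gram block on \<open>S\<close> together with the
  active set. A vector violating it would allow a move to another minimiser with strictly fewer
  active indices.\<close>

lemma sparse_minimizer_exists:
  assumes S: "S \<subseteq> I" "S \<noteq> {}" and \<tau>: "\<And>i. i \<in> S \<Longrightarrow> \<bar>\<tau> i\<bar> \<le> 1" and c: "0 < c"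
    and cone: "\<And>u. (\<Sum>i\<in>I - S. \<bar>u i\<bar>) \<le> (\<Sum>i\<in>S. \<bar>u i\<bar>) \<Longrightarrow> c * (\<Sum>i\<in>S. (u i)\<^sup>2) \<le> form u u"
  shows "\<exists>u. minimizer S \<tau> I u \<and>
    (\<forall>v. (\<forall>i. i \<notin> S \<union> {i \<in> I - S. u i \<noteq> 0} \<longrightarrow> v i = 0) \<longrightarrow>
         (\<forall>i \<in> S \<union> {i \<in> I - S. u i \<noteq> 0}. grad v i = 0) \<longrightarrow> v = (\<lambda>_. 0))"
proof -
  have "\<exists>u. minimizer S \<tau> I u"
    using S \<tau> c cone by (intro minimizer_exists[where c = c]) auto
  then obtain u where u: "minimizer S \<tau> I u"
    and least: "\<And>w. minimizer S \<tau> I w \<Longrightarrow> card {i \<in> I - S. u i \<noteq> 0} \<le> card {i \<in> I - S. w i \<noteq> 0}"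
    using ex_has_least_nat[of "minimizer S \<tau> I" _ "\<lambda>w. card {i \<in> I - S. w i \<noteq> 0}"] by blast
  define T where "T = {i \<in> I - S. u i \<noteq> 0}"
  have T: "T \<subseteq> I" "finite T" using finite_I by (auto simp: T_def)
  have fS: "finite S" using S finite_I finite_subset by auto
  have null: "v = (\<lambda>_. 0)" if v: "\<And>i. i \<notin> S \<union> T \<Longrightarrow> v i = 0" and gv: "\<And>i. i \<in> S \<union> T \<Longrightarrow> grad v i = 0" for v
  proof (cases "\<forall>i\<in>T. v i = 0")
    \<comment> \<open>Here \<open>v\<close> is supported in \<open>S\<close>, hence lies in the
      cone, where the form controls its entries on \<open>S\<close>.\<close>
    case True
    then have v0: "v i = 0" if "i \<notin> S" for i using v that by blast
    have "form v v = 0" using gv v by (subst form_eq_sum_subset[of "S \<union> T"]) (use S T in auto)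
    then have "c * (\<Sum>i\<in>S. (v i)\<^sup>2) \<le> 0"
      using cone[of v] v0 by (simp add: sum_nonneg)
    then have "(\<Sum>i\<in>S. (v i)\<^sup>2) = 0"
      using c by (simp add: mult_le_0_iff sum_nonneg antisym)
    then have "\<forall>i\<in>S. v i = 0" using fS by (simp add: sum_nonneg_eq_0_iff)
    then show ?thesis using v0 by blast
  next
    case False
    define P where "P = {i \<in> T. v i \<noteq> 0}"
    have "finite P" "P \<noteq> {}" using T False by (auto simp: P_def)
    \<comment> \<open>A ratio test as in the simplex method: along \<open>v\<close>, in the
      direction that shrinks it, the entry \<open>j\<close> is among the first to reach 0, so no
      active entry changes sign.\<close>
    then obtain j where j: "j \<in> P" "\<And>i. i \<in> P \<Longrightarrow> \<bar>u j\<bar> / \<bar>v j\<bar> \<le> \<bar>u i\<bar> / \<bar>v i\<bar>"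
      using ex_is_arg_min_if_finite[of P "\<lambda>i. \<bar>u i\<bar> / \<bar>v i\<bar>"] by (auto simp: is_arg_min_linorder)
    define t where "t = - u j / v j"
    define w where "w = (\<lambda>i. u i + t * v i)"
    have tv: "\<bar>t * v i\<bar> \<le> \<bar>u i\<bar>" if "i \<in> T" for i
    proof (cases "v i = 0")
      case False
      then show ?thesis using j(2)[of i] that by (simp add: t_def P_def abs_mult field_simps)
    qed simp
    \<comment> \<open>As \<open>grad v\<close> vanishes on the support of \<open>v\<close>, the
      vector is null and the quadratic part of the objective is constant along it.\<close>
    have "form v v = 0" using gv v by (subst form_eq_sum_subset[of "S \<union> T"]) (use S T in auto)
    moreover from this have "form v u = 0" using Cauchy_Schwarz[of v u] by simp
    ultimately have "form w w = form u u" unfolding w_def form_add by simp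
    moreover have "(\<Sum>i\<in>S. \<tau> i * w i) = (\<Sum>i\<in>S. \<tau> i * u i) - t * (\<Sum>i\<in>S. v i * grad u i)"
      using minimizer_grad_inside[OF u S(1) subset_refl]
      by (simp add: w_def algebra_simps sum.distrib sum_distrib_left sum_negf)
    \<comment> \<open>Without sign changes the absolute value is affine along the move, and its
      slope is minus \<open>v i * grad u i\<close>, just as for the linear penalty on
      \<open>S\<close>. The penalty therefore changes by \<open>- t * form v u\<close>, which is
      0.\<close>
    moreover have "\<bar>w i\<bar> = \<bar>u i\<bar> - t * (v i * grad u i)" if "i \<in> I - S" for i
    proof (cases "u i = 0")
      case True
      then show ?thesis using v that by (auto simp: w_def T_def)
    next
      case False
      then have "grad u i = - sgn (u i)" using minimizer_grad_outside(2)[OF u S(1) subset_refl that] by simp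
      moreover have "\<bar>t * v i\<bar> \<le> \<bar>u i\<bar>" using tv False that by (simp add: T_def)
      ultimately show ?thesis by (auto simp: w_def sgn_if abs_if split: if_splits)
    qed
    then have "(\<Sum>i\<in>I - S. \<bar>w i\<bar>) = (\<Sum>i\<in>I - S. \<bar>u i\<bar>) - t * (\<Sum>i\<in>I - S. v i * grad u i)"
      by (simp add: sum_subtractf sum_distrib_left)
    ultimately have "objective S \<tau> w = objective S \<tau> u - t * ((\<Sum>i\<in>S. v i * grad u i) + (\<Sum>i\<in>I - S. v i * grad u i))"
      by (simp add: objective_def algebra_simps)
    also have "(\<Sum>i\<in>S. v i * grad u i) + (\<Sum>i\<in>I - S. v i * grad u i) = form v u"
      unfolding form_def using sum.subset_diff[OF S(1) finite_I, of "\<lambda>i. v i * grad u i"] by simp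
    finally have "objective S \<tau> w = objective S \<tau> u" using \<open>form v u = 0\<close> by simp
    then have "minimizer S \<tau> I w"
      using u v S T unfolding minimizer_def w_def by auto
    then have "card T \<le> card {i \<in> I - S. w i \<noteq> 0}" using least by (simp add: T_def)
    moreover have "{i \<in> I - S. w i \<noteq> 0} \<subset> T"
    proof
      show "{i \<in> I - S. w i \<noteq> 0} \<subseteq> T" using v by (auto simp: w_def T_def)
      have "w j = 0" "j \<in> T" using j by (auto simp: w_def t_def P_def)
      then show "{i \<in> I - S. w i \<noteq> 0} \<noteq> T" by blast
    qed
    ultimately show ?thesis by (meson T(2) leD psubset_card_mono)
  qed
  show ?thesis
  proof (intro exI conjI allI impI)
    show "minimizer S \<tau> I u" by (fact u)
    fix v
    assume "\<forall>i. i \<notin> S \<union> {i \<in> I - S. u i \<noteq> 0} \<longrightarrow> v i = 0"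
      and "\<forall>i \<in> S \<union> {i \<in> I - S. u i \<noteq> 0}. grad v i = 0"
    then show "v = (\<lambda>_. 0)"
      unfolding T_def[symmetric] by (intro null) auto
  qed
qed

lemma minimizer_mult_grad:
  assumes u: "minimizer S \<tau> A u" and S: "S \<subseteq> A" "A \<subseteq> I" and i: "i \<notin> S"
  shows "u i * grad u i = - \<bar>u i\<bar>"
proof (cases "u i = 0")
  case False
  then have "i \<in> A - S" using u i by (auto simp: minimizer_def)
  then have "grad u i = - sgn (u i)" using minimizer_grad_outside(2)[OF u _ S(2)] S False by auto
  then show ?thesis by (simp add: abs_sgn)
qed simp

text \<open>The energy identity: stationarity paired with \<open>u\<close> itself. When
  \<open>A = S\<close>, the second sum vanishes.\<close>

lemma minimizer_form_eq:
  assumes u: "minimizer S \<tau> A u" and S: "S \<subseteq> A" "A \<subseteq> I"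
  shows "form u u = - (\<Sum>i\<in>S. \<tau> i * u i) - (\<Sum>i\<in>I - S. \<bar>u i\<bar>)"
proof -
  have "(\<Sum>i\<in>I - S. u i * grad u i) = - (\<Sum>i\<in>I - S. \<bar>u i\<bar>)"
    using minimizer_mult_grad[OF u S] by (simp add: sum_negf)
  moreover have "(\<Sum>i\<in>S. u i * grad u i) = - (\<Sum>i\<in>S. \<tau> i * u i)"
    using minimizer_grad_inside[OF u S] by (simp add: sum_negf mult.commute)
  moreover have "form u u = (\<Sum>i\<in>I - S. u i * grad u i) + (\<Sum>i\<in>S. u i * grad u i)"
    unfolding form_def using S finite_I by (intro sum.subset_diff) auto
  ultimately show ?thesis by simp
qed

text \<open>The first two bounds are read off from the energy identity and nonnegativity of the
  form. If \<open>u\<close> vanished on \<open>S\<close>, the cone inequality would make it vanish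
  on \<open>I\<close>, against \<open>grad u i = - \<tau> i\<close> on \<open>S\<close>.\<close>

lemma minimizer_cone:
  assumes u: "minimizer S \<tau> I u" and S: "S \<subseteq> I" and \<tau>: "\<And>i. i \<in> S \<Longrightarrow> \<bar>\<tau> i\<bar> = 1"
  shows "(\<Sum>i\<in>I - S. \<bar>u i\<bar>) \<le> (\<Sum>i\<in>S. \<bar>u i\<bar>)"
    and "form u u \<le> sqrt (card S) * L2_set u S"
    and "S \<noteq> {} \<Longrightarrow> \<exists>i\<in>S. u i \<noteq> 0"
proof -
  note fe = minimizer_form_eq[OF u S subset_refl]
  have le: "- (\<Sum>i\<in>S. \<tau> i * u i) \<le> (\<Sum>i\<in>S. \<bar>u i\<bar>)" by (rule sum_sign_le[OF \<tau>])
  then show c: "(\<Sum>i\<in>I - S. \<bar>u i\<bar>) \<le> (\<Sum>i\<in>S. \<bar>u i\<bar>)" using fe form_nonneg[of u] by linarith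
  have "0 \<le> (\<Sum>i\<in>I - S. \<bar>u i\<bar>)" by (rule sum_nonneg) simp
  then show "form u u \<le> sqrt (card S) * L2_set u S" using sum_abs_le_L2_set[of u S] le fe by linarith
  assume "S \<noteq> {}"
  then obtain i where i: "i \<in> S" by auto
  show "\<exists>i\<in>S. u i \<noteq> 0"
  proof (rule ccontr)
    assume "\<not> (\<exists>i\<in>S. u i \<noteq> 0)"
    then have u0: "\<forall>i\<in>S. u i = 0" by blast
    then have "(\<Sum>i\<in>I - S. \<bar>u i\<bar>) \<le> 0" using c by simp
    then have "(\<Sum>i\<in>I - S. \<bar>u i\<bar>) = 0" by (simp add: sum_nonneg antisym)
    then have "\<forall>i\<in>I - S. u i = 0" using finite_I by (simp add: sum_nonneg_eq_0_iff)
    then have "grad u i = 0" using u0 by (force simp: grad_def intro!: sum.neutral)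
    then show False using minimizer_grad_inside[OF u S subset_refl i] \<tau>[OF i] by simp
  qed
qed

text \<open>Here \<open>lam\<close>, \<open>phi\<close>, \<open>theta\<close> and \<open>D\<close>
  stand for Lambda(S,s), phi(S,2s), theta(S,s) and 1 + delta_s. Each enters only through the
  inequality it provides, which keeps the count apart from the infima and suprema defining
  them.\<close>

lemma active_set_card_less:
  fixes lam phi theta D :: real
  assumes S: "S \<subseteq> I" "S \<noteq> {}" and \<tau>: "\<And>i. i \<in> S \<Longrightarrow> \<bar>\<tau> i\<bar> = 1"
    and u: "minimizer S \<tau> I u"
    and pos: "0 < lam" "0 < phi" "phi \<le> lam" "0 \<le> theta"
    and phi: "\<And>N w. \<lbrakk>S \<subseteq> N; N \<subseteq> I; card N \<le> 2 * card S;
        (\<Sum>i\<in>I - S. \<bar>w i\<bar>) \<le> (\<Sum>i\<in>S. \<bar>w i\<bar>); \<exists>i\<in>S. w i \<noteq> 0;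
        \<And>i j. i \<in> I - N \<Longrightarrow> j \<in> N - S \<Longrightarrow> \<bar>w i\<bar> \<le> \<bar>w j\<bar>\<rbrakk>
      \<Longrightarrow> phi\<^sup>2 * (L2_set w N)\<^sup>2 \<le> form w w"
    and lam: "\<And>w. (\<And>i. i \<notin> S \<Longrightarrow> w i = 0) \<Longrightarrow> lam\<^sup>2 * (L2_set w S)\<^sup>2 \<le> form w w"
    and theta: "\<And>w z M. \<lbrakk>\<And>i. i \<notin> S \<Longrightarrow> w i = 0; \<And>i. i \<notin> M \<Longrightarrow> z i = 0; M \<subseteq> I - S; card M \<le> card S\<rbrakk>
      \<Longrightarrow> \<bar>form w z\<bar> \<le> theta * L2_set w S * L2_set z M"
    and D: "\<And>z M. \<lbrakk>\<And>i. i \<notin> M \<Longrightarrow> z i = 0; M \<subseteq> I - S; card M \<le> card S\<rbrakk>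
      \<Longrightarrow> form z z \<le> D * (L2_set z M)\<^sup>2"
    and small: "theta + sqrt (D * theta) < phi * lam"
  shows "card {i \<in> I - S. u i \<noteq> 0} < card S"
proof (rule ccontr)
  assume "\<not> card {i \<in> I - S. u i \<noteq> 0} < card S"
  then obtain M where M: "M \<subseteq> {i \<in> I - S. u i \<noteq> 0}" "card M = card S"
    by (meson not_less obtain_subset_with_card_n)
  define s where "s = card S"
  have fS: "finite S" using S finite_I finite_subset by auto
  then have s: "0 < s" using S by (simp add: s_def card_gt_0_iff)
  have fM: "finite M" using M(1) finite_I by (auto intro: finite_subset[of M I])
  define q where "q = sqrt s"
  have q: "0 < q" "q\<^sup>2 = s" "q * q = s" using s by (auto simp: q_def simp flip: power2_eq_square)

  note cone = minimizer_cone[OF u S(1) \<tau>]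
  have "\<exists>b. minimizer S \<tau> S b"
  proof (rule minimizer_exists[OF S S(1)])
    show "0 < phi\<^sup>2" using pos by simp
    show "phi\<^sup>2 * (\<Sum>i\<in>S. (w i)\<^sup>2) \<le> form w w" if "(\<Sum>i\<in>I - S. \<bar>w i\<bar>) \<le> (\<Sum>i\<in>S. \<bar>w i\<bar>)" for w
    proof (cases "\<exists>i\<in>S. w i \<noteq> 0")
      case True
      then show ?thesis using phi[of S w] S that by (simp add: L2_set_def sum_nonneg)
    qed (simp add: form_nonneg)
  qed (use \<tau> in auto)
  then obtain b where b: "minimizer S \<tau> S b" ..
  have b0: "b i = 0" if "i \<notin> S" for i using b that by (auto simp: minimizer_def)
  define nb where "nb = L2_set b S"
  have nb0: "0 \<le> nb" by (simp add: nb_def)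
  have "lam\<^sup>2 * nb\<^sup>2 \<le> form b b" using lam[of b] b0 by (simp add: nb_def)
  also have "form b b \<le> q * nb"
    using minimizer_form_eq[OF b subset_refl S(1)] b0 sum_sign_le[where S = S and \<tau> = \<tau> and u = b, OF \<tau>] sum_abs_le_L2_set[of b S]
    by (simp add: nb_def q_def s_def)
  finally have "lam\<^sup>2 * nb * nb \<le> q * nb" by (simp add: power2_eq_square mult.assoc)
  then have nb: "nb \<le> q / lam\<^sup>2"
    using nb0 q pos by (cases "nb = 0") (auto simp: field_simps)

  \<comment> \<open>The block bound is applied with \<open>g = grad b\<close>: the sum is then the
    inner product of \<open>b\<close> with the part of \<open>u\<close> off \<open>S\<close>, and
    orthogonality gives the constant \<open>theta * nb\<close> on each block.\<close>
  have "\<exists>N\<subseteq>I - S. card N \<le> s \<and> (I - S \<noteq> {} \<longrightarrow> N \<noteq> {}) \<and> (\<forall>i\<in>I - S - N. \<forall>j\<in>N. \<bar>u i\<bar> \<le> \<bar>u j\<bar>) \<and>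
    \<bar>\<Sum>j\<in>I - S. u j * grad b j\<bar> \<le> (theta * nb) * (L2_set u N + (\<Sum>j\<in>I - S. \<bar>u j\<bar>) / sqrt s)"
  proof (rule sum_mult_le_block_bound[OF _ s])
    fix M assume M: "M \<subseteq> I - S" "card M \<le> s"
    let ?z = "\<lambda>i. if i \<in> M then u i else 0"
    have "form ?z b = (\<Sum>j\<in>M. u j * grad b j)"
      using M by (subst form_eq_sum_subset[of M]) auto
    moreover have "L2_set ?z M = L2_set u M" by (rule L2_set_cong) auto
    ultimately show "\<bar>\<Sum>j\<in>M. u j * grad b j\<bar> \<le> (theta * nb) * L2_set u M"
      using theta[of b M ?z] b0 M by (simp add: s_def nb_def form_commute[of b])
  qed (use finite_I pos nb0 in auto)
  then obtain N where N: "N \<subseteq> I - S" "card N \<le> s" "I - S \<noteq> {} \<Longrightarrow> N \<noteq> {}"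
    "\<And>i j. i \<in> I - S - N \<Longrightarrow> j \<in> N \<Longrightarrow> \<bar>u i\<bar> \<le> \<bar>u j\<bar>"
    "\<bar>\<Sum>j\<in>I - S. u j * grad b j\<bar> \<le> theta * nb * (L2_set u N + (\<Sum>j\<in>I - S. \<bar>u j\<bar>) / q)"
    unfolding q_def by blast
  have fN: "finite N" using N(1) finite_I finite_subset by blast
  define X where "X = L2_set u (S \<union> N)"
  have mono: "L2_set u S \<le> X" "L2_set u N \<le> X"
    unfolding X_def L2_set_def using fS fN by (auto intro!: real_sqrt_le_mono sum_mono2)
  have X0: "0 \<le> X" by (simp add: X_def)
  have "phi\<^sup>2 * X\<^sup>2 \<le> form u u"
    unfolding X_def
  proof (rule phi)
    show "card (S \<union> N) \<le> 2 * card S" using card_Un_le[of S N] N(2) by (simp add: s_def)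
  qed (use S N cone(1) cone(3) in auto)
  also have "form u u \<le> q * L2_set u S" using cone(2) by (simp add: q_def s_def)
  also have "\<dots> \<le> q * X" using mono(1) q by (intro mult_left_mono) auto
  finally have "phi\<^sup>2 * X * X \<le> q * X" by (simp add: power2_eq_square mult.assoc)
  then have X: "X \<le> q / phi\<^sup>2"
    using X0 q pos by (cases "X = 0") (auto simp: field_simps)

  define Y where "Y = (\<Sum>i\<in>I - S. \<bar>u i\<bar>)"
  have Y0: "0 \<le> Y" unfolding Y_def by (rule sum_nonneg) simp
  \<comment> \<open>\<open>sqrt\<close> takes negative values at negative arguments, so the sign of
    \<open>D\<close> is needed before the root in \<open>small\<close> can be bounded below by 0.
    The test vector is the indicator of \<open>M\<close>.\<close>
  have D0: "0 \<le> D"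
  proof -
    let ?z = "\<lambda>i. if i \<in> M then 1 else 0"
    have "form ?z ?z \<le> D * (L2_set ?z M)\<^sup>2"
      using M by (intro D) auto
    moreover have "(L2_set ?z M)\<^sup>2 = (s :: real)"
      using M by (simp add: L2_set_def s_def)
    ultimately have "0 \<le> D * s" using form_nonneg[of ?z] by simp
    then show ?thesis using s by (simp add: zero_le_mult_iff)
  qed
  have theta_lam: "theta \<le> lam\<^sup>2"
  proof -
    have "0 \<le> sqrt (D * theta)" using pos D0 by simp
    then have "theta \<le> phi * lam" using small by linarith
    also have "\<dots> \<le> lam\<^sup>2" using pos by (simp add: power2_eq_square)
    finally show ?thesis .
  qed

  define d where "d = (\<lambda>i. u i + (-1) * b i)"
  have gd: "grad d i = grad u i - grad b i" for i
    unfolding d_def grad_add by simp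
  have d_eq: "d i = u i" if "i \<notin> S" for i
    using b0[OF that] by (simp add: d_def)
  have "form d d \<le> theta * nb * X"
  proof -
    \<comment> \<open>Both minimisers have gradient \<open>- \<tau>\<close> on \<open>S\<close>, so
      \<open>grad d\<close> vanishes there.\<close>
    have "(\<Sum>i\<in>S. d i * grad d i) = 0"
      using minimizer_grad_inside[OF u S(1) subset_refl] minimizer_grad_inside[OF b subset_refl S(1)]
      by (simp add: gd)
    then have "form d d = (\<Sum>i\<in>I - S. d i * grad d i)"
      unfolding form_def using sum.subset_diff[OF S(1) finite_I, of "\<lambda>i. d i * grad d i"] by simp
    also have "\<dots> = (\<Sum>i\<in>I - S. - \<bar>u i\<bar> - u i * grad b i)"
      using minimizer_mult_grad[OF u S(1) subset_refl]
      by (intro sum.cong refl) (simp add: gd d_eq right_diff_distrib)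
    also have "\<dots> = - Y - (\<Sum>i\<in>I - S. u i * grad b i)"
      by (simp add: Y_def sum_subtractf sum_negf)
    also have "\<dots> \<le> - Y + theta * nb * (L2_set u N + Y / q)"
      using N(5) by (simp add: Y_def)
    also have "\<dots> = theta * nb * L2_set u N + (theta * nb / q - 1) * Y"
      by (simp add: algebra_simps)
    \<comment> \<open>The coefficient of \<open>Y\<close> is at most
      \<open>theta / lam\<^sup>2 - 1\<close>, which is not positive.\<close>
    also have "\<dots> \<le> theta * nb * X + 0"
    proof (intro add_mono mult_left_mono mult_nonpos_nonneg)
      have "theta * nb \<le> lam\<^sup>2 * (q / lam\<^sup>2)" using theta_lam nb nb0 pos by (intro mult_mono) auto
      then show "theta * nb / q - 1 \<le> 0" using q pos by simp
    qed (use mono(2) pos nb0 Y0 in auto)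
    finally show ?thesis by simp
  qed
  also have "\<dots> \<le> theta * (q / lam\<^sup>2) * (q / phi\<^sup>2)"
    using nb X nb0 X0 pos q by (intro mult_mono mult_nonneg_nonneg) auto
  finally have dd: "form d d \<le> theta * (q / (phi * lam))\<^sup>2"
    by (simp add: power2_eq_square field_simps)

  define z where "z = (\<lambda>i. if i \<in> M then sgn (u i) else 0)"
  have Lz: "L2_set z M = q"
  proof -
    have "(\<Sum>i\<in>M. (z i)\<^sup>2) = (\<Sum>i\<in>M. 1)"
      using M by (intro sum.cong) (auto simp: z_def sgn_if)
    then show ?thesis using M by (simp add: L2_set_def q_def s_def)
  qed
  have "form z u = (\<Sum>i\<in>M. z i * grad u i)"
    using M by (intro form_eq_sum_subset) (auto simp: z_def)
  also have "\<dots> = (\<Sum>i\<in>M. - 1)"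
  proof (intro sum.cong refl)
    fix i assume "i \<in> M"
    then have "i \<in> I - S" "u i \<noteq> 0" using M by auto
    then have "grad u i = - sgn (u i)" using minimizer_grad_outside(2)[OF u S(1) subset_refl] by blast
    then show "z i * grad u i = - 1" using \<open>i \<in> M\<close> \<open>u i \<noteq> 0\<close> by (simp add: z_def sgn_if)
  qed
  finally have zu: "form z u = - s" using M by (simp add: s_def)
  \<comment> \<open>The two parts of u = b + d need different tools: \<open>b\<close> and
    \<open>z\<close> have disjoint supports, so orthogonality applies, while \<open>d\<close> has
    small energy and is paired with \<open>z\<close> by Cauchy-Schwarz.\<close>
  have "form z d = form z u + (-1) * form z b" unfolding d_def by (rule form_add_right)
  then have "s \<le> \<bar>form b z\<bar> + \<bar>form z d\<bar>" using zu by (simp add: form_commute[of b z])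
  also have "\<bar>form b z\<bar> \<le> theta * nb * q"
    using theta[of b M z] M b0 Lz by (auto simp: z_def nb_def)
  also have "theta * nb * q \<le> theta * (q / (phi * lam)) * q"
  proof (intro mult_right_mono mult_left_mono)
    have "q / lam\<^sup>2 \<le> q / (phi * lam)"
      using pos q by (intro divide_left_mono) (auto simp: power2_eq_square)
    then show "nb \<le> q / (phi * lam)" using nb by simp
  qed (use pos q in auto)
  also have "\<bar>form z d\<bar> \<le> sqrt (form z z) * sqrt (form d d)" by (rule Cauchy_Schwarz)
  also have "\<dots> \<le> sqrt (D * q\<^sup>2) * sqrt (theta * (q / (phi * lam))\<^sup>2)"
  proof (intro mult_mono real_sqrt_le_mono dd)
    show "form z z \<le> D * q\<^sup>2" using D[of M z] M Lz by (auto simp: z_def)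
  qed (use D0 form_nonneg in auto)
  also have "\<dots> = sqrt (D * theta) * q * (q / (phi * lam))"
    using q(1) pos by (simp add: real_sqrt_mult)
  finally have "real s * 1 \<le> s * ((theta + sqrt (D * theta)) / (phi * lam))"
    by (simp add: q(3)[symmetric] algebra_simps add_divide_distrib)
  then have "1 \<le> (theta + sqrt (D * theta)) / (phi * lam)" using s by (subst (asm) mult_le_cancel_left_pos) auto
  then show False using small pos by (simp add: pos_le_divide_eq)
qed

section \<open>Scaling, crude bounds and minimal Rayleigh quotients\<close>

lemma grad_scale: "grad (\<lambda>i. a * u i) i = a * grad u i"
  by (simp add: grad_def sum_distrib_left algebra_simps)

lemma form_scale: "form (\<lambda>i. a * u i) (\<lambda>i. a * u i) = a\<^sup>2 * form u u"
  by (simp add: form_def grad_scale sum_distrib_left power2_eq_square algebra_simps)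

lemma grad_cong: "(\<And>i. i \<in> I \<Longrightarrow> u i = v i) \<Longrightarrow> grad u j = grad v j"
  by (simp add: grad_def)

text \<open>Lets a vector \<open>vec p w\<close> be replaced by the function \<open>w\<close>: the
  entries of the former beyond \<open>p\<close> are unspecified, but the form never reads
  them.\<close>

lemma form_cong:
  "(\<And>i. i \<in> I \<Longrightarrow> u i = u' i) \<Longrightarrow> (\<And>i. i \<in> I \<Longrightarrow> v i = v' i) \<Longrightarrow> form u v = form u' v'"
  using grad_cong[of v v'] by (simp add: form_def)

text \<open>A deliberately crude bound. It only serves to show that the supremum for theta is finite
  and that some isometry constant is admissible.\<close>

lemma abs_form_le:
  "\<bar>form u v\<bar> \<le> (\<Sum>i\<in>I. \<Sum>j\<in>I. \<bar>\<sigma> i j\<bar>) * (L2_set u I * L2_set v I)"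
proof -
  have le: "\<bar>w i\<bar> \<le> L2_set w I" if "i \<in> I" for i and w :: "'i \<Rightarrow> real"
    using member_le_L2_set[OF finite_I that, of "\<lambda>i. \<bar>w i\<bar>"] by (simp add: L2_set_def)
  have "\<bar>form u v\<bar> = \<bar>\<Sum>i\<in>I. \<Sum>j\<in>I. \<sigma> i j * (u i * v j)\<bar>"
    by (simp add: form_def grad_def sum_distrib_left algebra_simps)
  also have "\<dots> \<le> (\<Sum>i\<in>I. \<Sum>j\<in>I. \<bar>\<sigma> i j * (u i * v j)\<bar>)"
    by (intro order_trans[OF sum_abs] sum_mono) simp
  also have "\<dots> \<le> (\<Sum>i\<in>I. \<Sum>j\<in>I. \<bar>\<sigma> i j\<bar> * (L2_set u I * L2_set v I))"
    unfolding abs_mult using le by (intro sum_mono mult_left_mono mult_mono) auto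
  also have "\<dots> = (\<Sum>i\<in>I. \<Sum>j\<in>I. \<bar>\<sigma> i j\<bar>) * (L2_set u I * L2_set v I)"
    by (simp add: sum_distrib_right)
  finally show ?thesis .
qed

text \<open>The form attains its minimum \<open>m\<close> on the compact unit sphere of vectors
  supported in \<open>S\<close>; by homogeneity it dominates \<open>m\<close> times the squared norm
  everywhere, with equality at the minimiser.\<close>

lemma rayleigh_minimum:
  assumes S: "S \<subseteq> I" "S \<noteq> {}"
  shows "\<exists>m v. (\<forall>i. i \<notin> S \<longrightarrow> v i = 0) \<and> L2_set v S = 1 \<and> (\<forall>i\<in>S. grad v i = m * v i) \<and>
    (\<forall>w. (\<forall>i. i \<notin> S \<longrightarrow> w i = 0) \<longrightarrow> m * (L2_set w S)\<^sup>2 \<le> form w w)"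
proof -
  have fS: "finite S" using S finite_I finite_subset by auto
  define K where "K = {u. \<forall>i. (i \<in> S \<longrightarrow> \<bar>u i\<bar> \<le> 1) \<and> (i \<notin> S \<longrightarrow> u i = 0)} \<inter> {u. (\<Sum>i\<in>S. (u i)\<^sup>2) = (1 :: real)}"
  have "compact K"
    unfolding K_def
    by (intro compact_Int_closed compact_box closed_Collect_eq continuous_intros continuous_on_coordinate)
  have K: "u \<in> K \<longleftrightarrow> (\<forall>i. i \<notin> S \<longrightarrow> u i = 0) \<and> (\<Sum>i\<in>S. (u i)\<^sup>2) = 1" for u
  proof -
    have "\<bar>u i\<bar> \<le> 1" if "(\<Sum>i\<in>S. (u i)\<^sup>2) = 1" "i \<in> S" for i
    proof -
      have "(u i)\<^sup>2 \<le> (\<Sum>i\<in>S. (u i)\<^sup>2)" using fS that(2) by (intro member_le_sum) auto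
      then show ?thesis using that(1) by (simp add: abs_square_le_1)
    qed
    then show ?thesis unfolding K_def by auto
  qed
  obtain j where j: "j \<in> S" using S by auto
  have "(\<lambda>i. if i = j then 1 else 0) \<in> K"
    unfolding K using j fS by (simp add: if_distrib[of "\<lambda>x. x\<^sup>2"] cong: if_cong)
  then have "K \<noteq> {}" by auto
  then have "\<exists>v\<in>K. \<forall>w\<in>K. form v v \<le> form w w"
    using \<open>compact K\<close> by (intro continuous_attains_inf continuous_on_form)
  then obtain v where v: "v \<in> K" "\<And>w. w \<in> K \<Longrightarrow> form v v \<le> form w w" by blast
  define m where "m = form v v"
  have min: "m * (\<Sum>i\<in>S. (w i)\<^sup>2) \<le> form w w" if w: "\<And>i. i \<notin> S \<Longrightarrow> w i = 0" for w
  proof (cases "(\<Sum>i\<in>S. (w i)\<^sup>2) = 0")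
    case True
    then show ?thesis using form_nonneg[of w] by simp
  next
    case False
    define r where "r = (\<Sum>i\<in>S. (w i)\<^sup>2)"
    have r: "0 < r" using False sum_nonneg[of S "\<lambda>i. (w i)\<^sup>2"] by (simp add: r_def)
    have "(\<Sum>i\<in>S. (1 / sqrt r * w i)\<^sup>2) = (1 / sqrt r)\<^sup>2 * r"
      unfolding power_mult_distrib r_def by (simp add: sum_distrib_left)
    also have "\<dots> = 1" using r by (simp add: power_divide)
    finally have "(\<lambda>i. 1 / sqrt r * w i) \<in> K" using w by (simp add: K)
    then have "m \<le> (1 / sqrt r)\<^sup>2 * form w w"
      unfolding m_def form_scale[symmetric] by (rule v(2))
    also have "\<dots> = form w w / r" using r by (simp add: power_divide)
    finally show ?thesis using r by (simp add: r_def[symmetric] field_simps)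
  qed
  have v0: "v i = 0" if "i \<notin> S" for i using v(1) K that by blast
  have v1: "(\<Sum>i\<in>S. (v i)\<^sup>2) = 1" using v(1) K by blast
  have "grad v i = m * v i" if i: "i \<in> S" for i
  proof -
    let ?e = "\<lambda>j. if j = i then 1 else 0 :: real"
    have iI: "i \<in> I" using i S by auto
    have e: "form ?e w = grad w i" for w
      using iI finite_I by (simp add: form_def if_distrib[of "\<lambda>x. x * _"] cong: if_cong)
    \<comment> \<open>The homogeneous inequality holds for all perturbations of \<open>v\<close>,
      not only along the sphere, so the vanishing slope yields the eigenvalue equation
      directly.\<close>
    have *: "0 \<le> t * (2 * (grad v i - m * v i)) + t\<^sup>2 * (grad ?e i - m)" for t
    proof -
      have "m * (\<Sum>j\<in>S. (v j + t * ?e j)\<^sup>2) \<le> form (\<lambda>j. v j + t * ?e j) (\<lambda>j. v j + t * ?e j)"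
        using v0 i by (intro min) auto
      also have "(\<Sum>j\<in>S. (v j + t * ?e j)\<^sup>2) = (\<Sum>j\<in>S. (v j)\<^sup>2 + (if j = i then 2 * t * v i + t\<^sup>2 else 0))"
        by (intro sum.cong) (auto simp: power2_eq_square algebra_simps)
      also have "\<dots> = 1 + 2 * t * v i + t\<^sup>2" using fS i v1 by (simp add: sum.distrib)
      finally show ?thesis by (simp add: form_add e m_def[symmetric] algebra_simps)
    qed
    have "0 \<le> 2 * (grad v i - m * v i)"
      by (rule nonneg_slope[where r = 1 and a = "grad ?e i - m"]) (use * in auto)
    moreover have "0 \<le> - (2 * (grad v i - m * v i))"
    proof (rule nonneg_slope[where r = 1 and a = "grad ?e i - m"])
      show "0 \<le> t * - (2 * (grad v i - m * v i)) + t\<^sup>2 * (grad ?e i - m)" for t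
        using *[of "- t"] by (simp add: algebra_simps)
    qed simp
    ultimately show ?thesis by simp
  qed
  moreover have "(L2_set w S)\<^sup>2 = (\<Sum>i\<in>S. (w i)\<^sup>2)" for w :: "'i \<Rightarrow> real"
    by (simp add: L2_set_def sum_nonneg)
  ultimately show ?thesis using v0 v1 min by (intro exI[of _ m] exI[of _ v]) (auto simp: L2_set_def)
qed

end

section \<open>Gram matrices and restricted constants\<close>

lemma bij_betw_pick:
  assumes "finite N"
  shows "bij_betw (pick N) {..<card N} N"
proof -
  have "inj_on (pick N) {..<card N}"
  proof (rule linorder_inj_onI)
    fix i j assume "i < j" "j \<in> {..<card N}"
    then show "pick N i \<noteq> pick N j" using pick_mono_le[of j N i] by simp
  qed auto
  moreover have "pick N ` {..<card N} \<subseteq> N" using pick_in_set_le by auto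
  ultimately have "pick N ` {..<card N} = N"
    using assms by (intro card_subset_eq) (auto simp: card_image)
  then show ?thesis using \<open>inj_on _ _\<close> by (simp add: bij_betw_def)
qed

lemma sub_vec_surj:
  assumes "x \<in> carrier_vec (card N)" "finite N"
  shows "\<exists>w. (\<forall>j. j \<notin> N \<longrightarrow> w j = 0) \<and> x = sub_vec N w"
proof (intro exI conjI)
  \<comment> \<open>The rank of \<open>j\<close> in \<open>N\<close> is the inverse of the
    enumeration \<open>pick N\<close>.\<close>
  let ?w = "\<lambda>j. if j \<in> N then x $ card {a \<in> N. a < j} else 0"
  show "x = sub_vec N ?w"
  proof (rule eq_vecI)
    fix i assume "i < dim_vec (sub_vec N ?w)"
    then have "i < card N" by (simp add: sub_vec_def)
    then show "x $ i = sub_vec N ?w $ i"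
      using pick_in_set_le[of i N] card_pick_le[of i N] by (simp add: sub_vec_def)
  qed (use assms in \<open>simp add: sub_vec_def\<close>)
qed auto

lemma integrable_mult_L2:
  assumes "in_L2 Q f" "in_L2 Q g"
  shows "integrable Q (\<lambda>x. f x * g x)"
proof (rule Bochner_Integration.integrable_bound)
  show "integrable Q (\<lambda>x. (f x)\<^sup>2 + (g x)\<^sup>2)" using assms by (auto simp: in_L2_def)
  show "(\<lambda>x. f x * g x) \<in> borel_measurable Q" using assms by (auto simp: in_L2_def)
  show "AE x in Q. norm (f x * g x) \<le> norm ((f x)\<^sup>2 + (g x)\<^sup>2)"
  proof (rule AE_I2)
    fix x
    have "2 * \<bar>f x * g x\<bar> \<le> (f x)\<^sup>2 + (g x)\<^sup>2"
      using sum_squares_bound[of "\<bar>f x\<bar>" "\<bar>g x\<bar>"] by (simp add: abs_mult)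
    then show "norm (f x * g x) \<le> norm ((f x)\<^sup>2 + (g x)\<^sup>2)" by simp
  qed
qed

text \<open>\<open>Least\<close> on the reals is informative only if the least value is attained.
  Closedness makes the infimum a member of the set.\<close>

lemma Least_closed:
  fixes P :: "real \<Rightarrow> bool"
  assumes "P x0" "\<And>x. P x \<Longrightarrow> l \<le> x" "closed {x. P x}"
  shows "P (Least P)"
proof -
  have bdd: "bdd_below {x. P x}" using assms(2) by (auto simp: bdd_below_def)
  then have "P (Inf {x. P x})" using closed_contains_Inf[of "{x. P x}"] assms by auto
  moreover have "Least P = Inf {x. P x}"
    using calculation cInf_lower[OF _ bdd] by (intro Least_equality) auto
  ultimately show ?thesis by simp
qed

section \<open>The quadratic form of a family in L2\<close>

locale L2_family =
  fixes Q :: "'a measure" and p :: nat and \<psi> :: "nat \<Rightarrow> 'a \<Rightarrow> real"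
  assumes in_L2: "\<And>j. j < p \<Longrightarrow> in_L2 Q (\<psi> j)"
begin

abbreviation gram :: "nat \<Rightarrow> nat \<Rightarrow> real" where
  "gram j k \<equiv> L2_inner Q (\<psi> j) (\<psi> k)"

lemma L2_inner_lin_fun:
  assumes "dim_vec \<beta> = p" "dim_vec \<gamma> = p"
  shows "L2_inner Q (lin_fun \<psi> \<beta>) (lin_fun \<psi> \<gamma>) = (\<Sum>j<p. \<beta> $ j * (\<Sum>k<p. gram j k * \<gamma> $ k))"
proof -
  have "L2_inner Q (lin_fun \<psi> \<beta>) (lin_fun \<psi> \<gamma>) =
      (\<integral>x. (\<Sum>j<p. \<Sum>k<p. \<beta> $ j * \<gamma> $ k * (\<psi> j x * \<psi> k x)) \<partial>Q)"
    unfolding L2_inner_def lin_fun_def assms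
    by (intro Bochner_Integration.integral_cong refl) (simp add: sum_product algebra_simps)
  also have "\<dots> = (\<Sum>j<p. \<integral>x. (\<Sum>k<p. \<beta> $ j * \<gamma> $ k * (\<psi> j x * \<psi> k x)) \<partial>Q)"
    by (intro Bochner_Integration.integral_sum Bochner_Integration.integrable_sum
        integrable_mult_right integrable_mult_L2 in_L2) auto
  also have "\<dots> = (\<Sum>j<p. \<Sum>k<p. \<integral>x. \<beta> $ j * \<gamma> $ k * (\<psi> j x * \<psi> k x) \<partial>Q)"
    by (intro sum.cong refl Bochner_Integration.integral_sum integrable_mult_right
        integrable_mult_L2 in_L2) auto
  also have "\<dots> = (\<Sum>j<p. \<Sum>k<p. \<beta> $ j * \<gamma> $ k * gram j k)"
    by (simp add: L2_inner_def)
  finally show ?thesis by (simp add: sum_distrib_left algebra_simps)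
qed

text \<open>Semidefiniteness holds because the quadratic form at \<open>u\<close> is the integral of
  the square of f_u.\<close>

sublocale psd_form "{..<p}" gram
proof
  show "gram i j = gram j i" for i j by (simp add: L2_inner_def mult.commute)
  fix u :: "nat \<Rightarrow> real"
  have "0 \<le> L2_inner Q (lin_fun \<psi> (vec p u)) (lin_fun \<psi> (vec p u))"
    unfolding L2_inner_def by (intro Bochner_Integration.integral_nonneg) simp
  then show "0 \<le> (\<Sum>i<p. u i * (\<Sum>j<p. gram i j * u j))"
    by (subst (asm) L2_inner_lin_fun) simp_all
qed simp

lemma L2_inner_eq_form:
  assumes "dim_vec \<beta> = p" "dim_vec \<gamma> = p"
  shows "L2_inner Q (lin_fun \<psi> \<beta>) (lin_fun \<psi> \<gamma>) = form (($) \<beta>) (($) \<gamma>)"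
  using L2_inner_lin_fun[OF assms] by (simp add: form_def grad_def)

lemma L2_norm_eq_form:
  assumes "dim_vec \<beta> = p"
  shows "(L2_norm Q (lin_fun \<psi> \<beta>))\<^sup>2 = form (($) \<beta>) (($) \<beta>)"
  by (simp add: L2_norm_def L2_inner_eq_form[OF assms assms] form_nonneg)

abbreviation \<Sigma> :: "real mat" where
  "\<Sigma> \<equiv> gram_mat Q p \<psi>"

section \<open>The restricted constants as inequalities\<close>

lemma l2_norm_restr_vec:
  assumes "dim_vec \<beta> = p" "N \<subseteq> {..<p}"
  shows "l2_norm (restr_vec N \<beta>) = L2_set (($) \<beta>) N"
proof -
  have "(\<Sum>j<p. (restr_vec N \<beta> $ j)\<^sup>2) = (\<Sum>j\<in>N. (\<beta> $ j)\<^sup>2)"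
    using assms by (intro sum.mono_neutral_cong_right) (auto simp: restr_vec_def)
  then show ?thesis using assms by (simp add: l2_norm_def L2_set_def restr_vec_def)
qed

lemma l1_norm_restr_vec:
  assumes "dim_vec \<beta> = p"
  shows "l1_norm (restr_vec N \<beta>) = (\<Sum>j\<in>{..<p} \<inter> N. \<bar>\<beta> $ j\<bar>)"
proof -
  have "(\<Sum>j<p. \<bar>restr_vec N \<beta> $ j\<bar>) = (\<Sum>j\<in>{..<p} \<inter> N. \<bar>\<beta> $ j\<bar>)"
    using assms by (intro sum.mono_neutral_cong_right) (auto simp: restr_vec_def)
  then show ?thesis using assms by (simp add: l1_norm_def restr_vec_def)
qed

lemma vec_mem_restricted_set:
  assumes S: "S \<subseteq> N" "N \<subseteq> {..<p}"
    and cone: "(\<Sum>i\<in>{..<p} - S. \<bar>w i\<bar>) \<le> (\<Sum>i\<in>S. \<bar>w i\<bar>)" "\<exists>i\<in>S. w i \<noteq> 0"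
    and dom: "\<And>i j. i \<in> {..<p} - N \<Longrightarrow> j \<in> N - S \<Longrightarrow> \<bar>w i\<bar> \<le> \<bar>w j\<bar>"
  shows "vec p w \<in> restricted_set p S N"
  unfolding restricted_set_def
proof (intro CollectI conjI impI)
  have fN: "finite N" "finite S" using S finite_subset[OF _ finite_lessThan] by blast+
  have a: "l1_norm (restr_vec S (vec p w)) = (\<Sum>i\<in>S. \<bar>w i\<bar>)"
    using S by (subst l1_norm_restr_vec) (auto intro!: sum.cong)
  moreover have "l1_norm (restr_vec (- S) (vec p w)) = (\<Sum>i\<in>{..<p} - S. \<bar>w i\<bar>)"
    by (subst l1_norm_restr_vec) (auto intro!: sum.cong)
  ultimately show "l1_norm (restr_vec (- S) (vec p w)) \<le> l1_norm (restr_vec S (vec p w))"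
    using cone by simp
  show "l1_norm (restr_vec S (vec p w)) \<noteq> 0"
    unfolding a using cone(2) fN by (auto simp: sum_nonneg_eq_0_iff)
  assume "N \<noteq> S"
  then have "N - S \<noteq> {}" using S by auto
  \<comment> \<open>Pairwise domination covers the entries off \<open>N\<close>; the inserted 0 and
    the entries zeroed by the restriction are harmless because the right-hand side is a minimum of
    absolute values.\<close>
  then show "linf_norm (restr_vec (- N) (vec p w)) \<le> (MIN j\<in>N - S. \<bar>vec p w $ j\<bar>)"
    using fN S dom by (subst Min_ge_iff) (auto simp: linf_norm_def restr_vec_def subset_iff)
qed simp

text \<open>The vector \<open>w\<close> also witnesses that the infimum is over a nonempty set. For
  an empty set its value would be unspecified, so nonnegativity is stated under the same
  hypotheses.\<close>

lemma restricted_eigenvalue_le: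
  assumes S: "S \<subseteq> N" "N \<subseteq> {..<p}" "card N \<le> L"
    and cone: "(\<Sum>i\<in>{..<p} - S. \<bar>w i\<bar>) \<le> (\<Sum>i\<in>S. \<bar>w i\<bar>)" "\<exists>i\<in>S. w i \<noteq> 0"
    and dom: "\<And>i j. i \<in> {..<p} - N \<Longrightarrow> j \<in> N - S \<Longrightarrow> \<bar>w i\<bar> \<le> \<bar>w j\<bar>"
  shows "(restricted_eigenvalue Q p \<psi> S L)\<^sup>2 * (L2_set w N)\<^sup>2 \<le> form w w"
    and "0 \<le> restricted_eigenvalue Q p \<psi> S L"
proof -
  define R where "R = {(L2_norm Q (lin_fun \<psi> \<beta>))\<^sup>2 / (l2_norm (restr_vec N \<beta>))\<^sup>2 | N \<beta>.
                  S \<subseteq> N \<and> N \<subseteq> {..<p} \<and> card N \<le> L \<and> \<beta> \<in> restricted_set p S N}"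
  have "form (($) (vec p w)) (($) (vec p w)) = form w w" by (rule form_cong) auto
  moreover have "L2_set (($) (vec p w)) N = L2_set w N" using S by (intro L2_set_cong) auto
  ultimately have mem: "form w w / (L2_set w N)\<^sup>2 \<in> R"
    unfolding R_def using S vec_mem_restricted_set[OF S(1,2) cone dom]
    by (intro CollectI exI[of _ N] exI[of _ "vec p w"]) (simp add: L2_norm_eq_form l2_norm_restr_vec)
  have nonneg: "0 \<le> x" if "x \<in> R" for x using that by (auto simp: R_def)
  then have "bdd_below R" by (auto simp: bdd_below_def)
  then have le: "Inf R \<le> form w w / (L2_set w N)\<^sup>2" using mem by (intro cInf_lower)
  have "0 \<le> Inf R" using mem nonneg by (intro cInf_greatest) auto
  moreover have phi: "restricted_eigenvalue Q p \<psi> S L = sqrt (Inf R)"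
    by (simp add: restricted_eigenvalue_def R_def)
  ultimately show "0 \<le> restricted_eigenvalue Q p \<psi> S L" by simp
  have "finite N" using S(2) finite_subset by blast
  then have "L2_set w N \<noteq> 0" using S cone(2) by (auto simp: L2_set_eq_0_iff)
  then have "0 < (L2_set w N)\<^sup>2" by simp
  then show "(restricted_eigenvalue Q p \<psi> S L)\<^sup>2 * (L2_set w N)\<^sup>2 \<le> form w w"
    unfolding phi using le \<open>0 \<le> Inf R\<close> by (simp add: pos_le_divide_eq)
qed

lemma restricted_orthogonality_bound:
  assumes S: "S \<subseteq> {..<p}" and w: "\<And>i. i \<notin> S \<Longrightarrow> w i = 0" and z: "\<And>i. i \<notin> M \<Longrightarrow> z i = 0"
    and M: "M \<subseteq> {..<p} - S" "card M \<le> s"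
  shows "\<bar>form w z\<bar> \<le> restricted_orthogonality Q p \<psi> S s * L2_set w S * L2_set z M"
    and "0 \<le> restricted_orthogonality Q p \<psi> S s"
proof -
  define R where "R = insert 0
       {\<bar>L2_inner Q (lin_fun \<psi> (restr_vec S \<beta>)) (lin_fun \<psi> (restr_vec M \<beta>))\<bar>
          / (l2_norm (restr_vec S \<beta>) * l2_norm (restr_vec M \<beta>)) | M \<beta>.
        M \<subseteq> {..<p} - S \<and> card M \<le> s \<and> \<beta> \<in> carrier_vec p \<and>
        restr_vec S \<beta> \<noteq> 0\<^sub>v p \<and> restr_vec M \<beta> \<noteq> 0\<^sub>v p}"
  have theta: "restricted_orthogonality Q p \<psi> S s = Sup R"
    by (simp add: restricted_orthogonality_def R_def)
  define C where "C = (\<Sum>i<p. \<Sum>j<p. \<bar>gram i j\<bar>)"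
  have C: "0 \<le> C" unfolding C_def by (intro sum_nonneg) simp
  have "x \<le> C" if "x \<in> R" for x
    using that unfolding R_def
  proof (elim insertE CollectE exE conjE)
    fix N \<beta> assume N: "N \<subseteq> {..<p} - S" and \<beta>: "\<beta> \<in> carrier_vec p"
      and x: "x = \<bar>L2_inner Q (lin_fun \<psi> (restr_vec S \<beta>)) (lin_fun \<psi> (restr_vec N \<beta>))\<bar>
          / (l2_norm (restr_vec S \<beta>) * l2_norm (restr_vec N \<beta>))"
    have d: "dim_vec (restr_vec A \<beta>) = p" for A using \<beta> by (simp add: restr_vec_def)
    have L: "L2_set (($) (restr_vec A \<beta>)) {..<p} = l2_norm (restr_vec A \<beta>)" for A
      by (simp add: L2_set_def l2_norm_def d)
    define n where "n = l2_norm (restr_vec S \<beta>) * l2_norm (restr_vec N \<beta>)"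
    have "\<bar>L2_inner Q (lin_fun \<psi> (restr_vec S \<beta>)) (lin_fun \<psi> (restr_vec N \<beta>))\<bar> \<le> C * n"
      unfolding L2_inner_eq_form[OF d d] C_def n_def L[symmetric] by (rule abs_form_le)
    moreover have "0 \<le> n"
      by (simp add: n_def l2_norm_def sum_nonneg)
    ultimately show "x \<le> C"
      unfolding x n_def[symmetric] using C by (simp add: divide_le_eq)
  qed (use C in simp)
  then have bdd: "bdd_above R" by (auto simp: bdd_above_def)
  show theta0: "0 \<le> restricted_orthogonality Q p \<psi> S s"
    unfolding theta by (rule cSup_upper[OF _ bdd]) (simp add: R_def)
  have fin: "finite S" "finite M" using S M finite_subset[OF _ finite_lessThan] by blast+
  show "\<bar>form w z\<bar> \<le> restricted_orthogonality Q p \<psi> S s * L2_set w S * L2_set z M"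
  \<comment> \<open>Zero vectors are excluded from the supremum and are treated separately.\<close>
  proof (cases "L2_set w S = 0 \<or> L2_set z M = 0")
    case True
    then have "w = (\<lambda>_. 0) \<or> z = (\<lambda>_. 0)" using fin w z by (auto simp: L2_set_eq_0_iff fun_eq_iff)
    then show ?thesis using theta0 by (auto simp: form_def grad_def)
  next
    case False
    \<comment> \<open>The definition takes both restrictions from one vector; gluing
      \<open>w\<close> and \<open>z\<close> is possible because \<open>S\<close> and
      \<open>M\<close> are disjoint.\<close>
    define \<beta> where "\<beta> = vec p (\<lambda>j. if j \<in> S then w j else z j)"
    have d: "dim_vec (restr_vec A \<beta>) = p" "dim_vec \<beta> = p" for A by (simp_all add: restr_vec_def \<beta>_def)
    have MI: "M \<subseteq> {..<p}" using M by auto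
    have "form (($) (restr_vec S \<beta>)) (($) (restr_vec M \<beta>)) = form w z"
      using w z M by (intro form_cong) (auto simp: restr_vec_def \<beta>_def)
    moreover have "L2_set (($) \<beta>) S = L2_set w S"
      using S by (intro L2_set_cong) (auto simp: \<beta>_def)
    moreover have "L2_set (($) \<beta>) M = L2_set z M"
      using M by (intro L2_set_cong) (auto simp: \<beta>_def)
    ultimately have ratio: "\<bar>form w z\<bar> / (L2_set w S * L2_set z M) =
        \<bar>L2_inner Q (lin_fun \<psi> (restr_vec S \<beta>)) (lin_fun \<psi> (restr_vec M \<beta>))\<bar>
          / (l2_norm (restr_vec S \<beta>) * l2_norm (restr_vec M \<beta>))"
      using l2_norm_restr_vec[OF d(2) S] l2_norm_restr_vec[OF d(2) MI] by (simp add: L2_inner_eq_form[OF d(1) d(1)])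
    have "restr_vec S \<beta> \<noteq> 0\<^sub>v p"
    proof
      assume eq: "restr_vec S \<beta> = 0\<^sub>v p"
      have "w i = 0" if "i \<in> S" for i
        using arg_cong[OF eq, of "\<lambda>v. v $ i"] that S by (auto simp: restr_vec_def \<beta>_def subset_iff)
      then show False using False fin by (simp add: L2_set_eq_0_iff)
    qed
    moreover have "restr_vec M \<beta> \<noteq> 0\<^sub>v p"
    proof
      assume eq: "restr_vec M \<beta> = 0\<^sub>v p"
      have "z i = 0" if "i \<in> M" for i
        using arg_cong[OF eq, of "\<lambda>v. v $ i"] that M by (auto simp: restr_vec_def \<beta>_def subset_iff)
      then show False using False fin by (simp add: L2_set_eq_0_iff)
    qed
    ultimately have "\<bar>form w z\<bar> / (L2_set w S * L2_set z M) \<in> R"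
      unfolding R_def using M ratio
      by (intro insertI2 CollectI exI[of _ M] exI[of _ \<beta>] conjI) (simp_all add: \<beta>_def)
    then have "\<bar>form w z\<bar> / (L2_set w S * L2_set z M) \<le> Sup R" using bdd by (rule cSup_upper)
    moreover have "0 < L2_set w S * L2_set z M" using False by (simp add: order_less_le)
    ultimately show ?thesis unfolding theta by (simp add: pos_divide_le_eq mult.assoc)
  qed
qed

lemma restricted_isometry_bound:
  assumes z: "\<And>i. i \<notin> M \<Longrightarrow> z i = 0" and M: "M \<subseteq> {..<p}" "card M \<le> s" and "0 < p" "0 < s"
  shows "form z z \<le> (1 + restricted_isometry Q p \<psi> s) * (L2_set z M)\<^sup>2"
proof -
  define P where "P = (\<lambda>\<delta>. \<forall>\<beta>\<in>carrier_vec p. \<forall>N. N \<subseteq> {..<p} \<and> card N \<le> s \<longrightarrow>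
        (1 - \<delta>) * (l2_norm (restr_vec N \<beta>))\<^sup>2 \<le> (L2_norm Q (lin_fun \<psi> (restr_vec N \<beta>)))\<^sup>2 \<and>
        (L2_norm Q (lin_fun \<psi> (restr_vec N \<beta>)))\<^sup>2 \<le> (1 + \<delta>) * (l2_norm (restr_vec N \<beta>))\<^sup>2)"
  have d: "dim_vec (restr_vec A \<beta>) = dim_vec \<beta>" for A \<beta> by (simp add: restr_vec_def)
  define C where "C = (\<Sum>i<p. \<Sum>j<p. \<bar>gram i j\<bar>)"
  have C: "0 \<le> C" unfolding C_def by (intro sum_nonneg) simp
  \<comment> \<open>From 1 on, the lower isometry estimate is trivial, and the crude bound
    \<open>C\<close> gives the upper one.\<close>
  have "P (1 + C)"
    unfolding P_def
  proof (intro ballI allI impI conjI)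
    fix \<beta> :: "real vec" and N assume \<beta>: "\<beta> \<in> carrier_vec p"
    let ?b = "restr_vec N \<beta>"
    have db: "dim_vec ?b = p" using \<beta> d by auto
    have L: "L2_set (($) ?b) {..<p} = l2_norm ?b"
      by (simp add: L2_set_def l2_norm_def db)
    have "(1 - (1 + C)) * (l2_norm ?b)\<^sup>2 \<le> 0" using C by (simp add: mult_nonneg_nonpos)
    then show "(1 - (1 + C)) * (l2_norm ?b)\<^sup>2 \<le> (L2_norm Q (lin_fun \<psi> ?b))\<^sup>2"
      by (rule order_trans) simp
    have "(L2_norm Q (lin_fun \<psi> ?b))\<^sup>2 \<le> C * (l2_norm ?b)\<^sup>2"
      using abs_form_le[of "($) ?b" "($) ?b"] unfolding L2_norm_eq_form[OF db] L C_def
      by (simp add: power2_eq_square)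
    also have "\<dots> \<le> (1 + (1 + C)) * (l2_norm ?b)\<^sup>2" by (intro mult_right_mono) auto
    finally show "(L2_norm Q (lin_fun \<psi> ?b))\<^sup>2 \<le> (1 + (1 + C)) * (l2_norm ?b)\<^sup>2" .
  qed
  \<comment> \<open>The two estimates at a unit vector give
    \<open>1 - \<delta> \<le> 1 + \<delta>\<close>. Positivity of \<open>p\<close> and
    \<open>s\<close> makes this vector admissible; otherwise all norms involved are 0 and every
    \<open>\<delta>\<close> qualifies.\<close>
  moreover have "0 \<le> \<delta>" if "P \<delta>" for \<delta>
  proof -
    have "(1 - \<delta>) * (l2_norm (restr_vec {0} (vec p (\<lambda>_. 1))))\<^sup>2 \<le> (1 + \<delta>) * (l2_norm (restr_vec {0} (vec p (\<lambda>_. 1))))\<^sup>2"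
      using that[unfolded P_def, rule_format, of "vec p (\<lambda>_. 1)" "{0}"] assms(4,5) by force
    moreover have "l2_norm (restr_vec {0} (vec p (\<lambda>_. 1))) = 1"
      using assms(4) by (subst l2_norm_restr_vec) (auto simp: L2_set_def)
    ultimately show ?thesis by simp
  qed
  moreover have "closed {\<delta>. P \<delta>}"
    unfolding P_def Ball_def
    by (intro closed_Collect_all closed_Collect_imp closed_Collect_conj closed_Collect_le
        open_Collect_const continuous_intros)
  ultimately have "P (Least P)" by (rule Least_closed)
  moreover have "Least P = restricted_isometry Q p \<psi> s"
    by (simp add: restricted_isometry_def P_def)
  ultimately have "P (restricted_isometry Q p \<psi> s)" by simp
  from this[unfolded P_def, rule_format, of "vec p z" M] M
  have "(L2_norm Q (lin_fun \<psi> (restr_vec M (vec p z))))\<^sup>2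
      \<le> (1 + restricted_isometry Q p \<psi> s) * (l2_norm (restr_vec M (vec p z)))\<^sup>2" by simp
  also have "l2_norm (restr_vec M (vec p z)) = L2_set z M"
    using M by (subst l2_norm_restr_vec) (auto intro!: L2_set_cong)
  also have "(L2_norm Q (lin_fun \<psi> (restr_vec M (vec p z))))\<^sup>2 = form z z"
    using z by (subst L2_norm_eq_form) (auto simp: restr_vec_def intro!: form_cong)
  finally show ?thesis .
qed

section \<open>Blocks of the Gram matrix\<close>

text \<open>The dictionary between matrices indexed by rank and \<open>grad\<close> indexed by the
  original coordinates. It is used with \<open>R = N\<close> for the square block and with the
  complement of \<open>N\<close> for the lower block.\<close>

lemma submatrix_gram_mult_sub_vec:
  assumes R: "R \<subseteq> {..<p}" and N: "N \<subseteq> {..<p}" and w: "\<And>j. j \<notin> N \<Longrightarrow> w j = 0"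
  shows "submatrix \<Sigma> R N *\<^sub>v sub_vec N w = sub_vec R (grad w)"
proof (rule eq_vecI)
  have cR: "card {i. i < p \<and> i \<in> R} = card R" using R by (intro arg_cong[of _ _ card]) auto
  have cN: "card {i. i < p \<and> i \<in> N} = card N" using N by (intro arg_cong[of _ _ card]) auto
  show "dim_vec (submatrix \<Sigma> R N *\<^sub>v sub_vec N w) = dim_vec (sub_vec R (grad w))"
    by (simp add: submatrix_def gram_mat_def sub_vec_def cR)
  have fN: "finite N" using N finite_subset by blast
  fix i assume "i < dim_vec (sub_vec R (grad w))"
  then have i: "i < card R" by (simp add: sub_vec_def)
  then have pi: "pick R i < p" using pick_in_set_le[of i R] R by auto
  have "(submatrix \<Sigma> R N *\<^sub>v sub_vec N w) $ i = (\<Sum>j<card N. gram (pick R i) (pick N j) * w (pick N j))"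
    using i pi pick_in_set_le[of _ N] N
    by (auto simp: submatrix_def gram_mat_def sub_vec_def cR cN scalar_prod_def lessThan_atLeast0 subset_iff intro!: sum.cong)
  also have "\<dots> = (\<Sum>k\<in>N. gram (pick R i) k * w k)"
    by (rule sum.reindex_bij_betw[OF bij_betw_pick[OF fN]])
  also have "\<dots> = grad w (pick R i)"
    unfolding grad_def using N w by (intro sum.mono_neutral_left) auto
  finally show "(submatrix \<Sigma> R N *\<^sub>v sub_vec N w) $ i = sub_vec R (grad w) $ i"
    using i by (simp add: sub_vec_def)
qed

lemma block11_carrier: "N \<subseteq> {..<p} \<Longrightarrow> block11 \<Sigma> N \<in> carrier_mat (card N) (card N)"
  by (simp add: block11_def submatrix_def gram_mat_def Collect_conj_eq inf.absorb2
      flip: lessThan_def)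

lemma sub_vec_eq_iff: "finite N \<Longrightarrow> sub_vec N u = sub_vec N v \<longleftrightarrow> (\<forall>j\<in>N. u j = v j)"
proof
  assume fin: "finite N" and eq: "sub_vec N u = sub_vec N v"
  have "u (pick N i) = v (pick N i)" if "i < card N" for i
    using arg_cong[OF eq, of "\<lambda>x. x $ i"] that by (simp add: sub_vec_def)
  then show "\<forall>j\<in>N. u j = v j"
    using bij_betw_imp_surj_on[OF bij_betw_pick[OF fin]] by (metis imageE lessThan_iff)
next
  assume "\<forall>j\<in>N. u j = v j"
  then show "sub_vec N u = sub_vec N v" using pick_in_set_le[of _ N] by (auto simp: sub_vec_def)
qed

text \<open>The minimal Rayleigh quotient is an eigenvalue, so the least eigenvalue lies below it
  and the inequality follows. Conversely, an eigenvector of the least eigenvalue, extended by 0 off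
  \<open>S\<close>, gives equality.\<close>

lemma Lambda_min_bounds:
  assumes S: "S \<subseteq> {..<p}" "S \<noteq> {}" and pos: "0 < min_eigenvalue (block11 \<Sigma> S)"
  shows "\<And>w. (\<And>i. i \<notin> S \<Longrightarrow> w i = 0) \<Longrightarrow> (Lambda_min Q p \<psi> S)\<^sup>2 * (L2_set w S)\<^sup>2 \<le> form w w"
    and "\<exists>v. (\<forall>i. i \<notin> S \<longrightarrow> v i = 0) \<and> L2_set v S \<noteq> 0 \<and> form v v = (Lambda_min Q p \<psi> S)\<^sup>2 * (L2_set v S)\<^sup>2"
proof -
  let ?A = "block11 \<Sigma> S"
  have fS: "finite S" using S finite_subset by blast
  have A: "?A \<in> carrier_mat (card S) (card S)" using S(1) by (rule block11_carrier)
  have Lam: "(Lambda_min Q p \<psi> S)\<^sup>2 = Min (spectrum ?A)"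
    using pos by (simp add: Lambda_min_def min_eigenvalue_def)
  have fin: "finite (spectrum ?A)" using A by (rule card_finite_spectrum)
  have mult: "?A *\<^sub>v sub_vec S w = sub_vec S (grad w)" if "\<forall>i. i \<notin> S \<longrightarrow> w i = 0" for w
    unfolding block11_def using S(1) that by (intro submatrix_gram_mult_sub_vec) auto
  have smult: "k \<cdot>\<^sub>v sub_vec S w = sub_vec S (\<lambda>i. k * w i)" for k w by (auto simp: sub_vec_def)
  have zero: "0\<^sub>v (card S) = sub_vec S (\<lambda>_. 0)" by (auto simp: sub_vec_def)
  have dS: "dim_row ?A = card S" using A by simp
  obtain m v where v: "\<And>i. i \<notin> S \<Longrightarrow> v i = 0" "L2_set v S = 1"
    and ev: "\<And>i. i \<in> S \<Longrightarrow> grad v i = m * v i"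
    and le: "\<And>w. \<forall>i. i \<notin> S \<longrightarrow> w i = 0 \<Longrightarrow> m * (L2_set w S)\<^sup>2 \<le> form w w"
    using rayleigh_minimum[OF S] by blast
  have "sub_vec S v \<noteq> 0\<^sub>v (card S)"
    unfolding zero sub_vec_eq_iff[OF fS] using v(2) L2_set_0'[of S v] by auto
  moreover have "?A *\<^sub>v sub_vec S v = m \<cdot>\<^sub>v sub_vec S v"
    unfolding smult by (subst mult) (use v ev fS in \<open>auto simp: sub_vec_eq_iff\<close>)
  ultimately have m: "m \<in> spectrum ?A"
    unfolding spectrum_def eigenvalue_def eigenvector_def dS
    by (intro CollectI exI[of _ "sub_vec S v"]) (simp add: sub_vec_def)
  show "(Lambda_min Q p \<psi> S)\<^sup>2 * (L2_set w S)\<^sup>2 \<le> form w w" if "\<And>i. i \<notin> S \<Longrightarrow> w i = 0" for w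
  proof -
    have "Min (spectrum ?A) * (L2_set w S)\<^sup>2 \<le> m * (L2_set w S)\<^sup>2"
      using fin m by (intro mult_right_mono) auto
    then show ?thesis unfolding Lam using le[of w] that by simp
  qed
  have "Min (spectrum ?A) \<in> spectrum ?A" using fin m by (intro Min_in) auto
  then obtain x where x: "x \<in> carrier_vec (card S)" "x \<noteq> 0\<^sub>v (card S)" "?A *\<^sub>v x = Min (spectrum ?A) \<cdot>\<^sub>v x"
    unfolding spectrum_def eigenvalue_def eigenvector_def dS by auto
  obtain y where y: "\<forall>j. j \<notin> S \<longrightarrow> y j = 0" "x = sub_vec S y" using sub_vec_surj[OF x(1) fS] by blast
  have gy: "\<forall>i\<in>S. grad y i = Min (spectrum ?A) * y i"
    using x(3) unfolding y(2) mult[OF y(1)] smult sub_vec_eq_iff[OF fS] .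
  have "L2_set y S \<noteq> 0" using x(2) fS unfolding y(2) zero sub_vec_eq_iff[OF fS] by (auto simp: L2_set_eq_0_iff)
  moreover have "form y y = (\<Sum>i\<in>S. y i * grad y i)"
    using S(1) y(1) by (intro form_eq_sum_subset) auto
  then have "form y y = Min (spectrum ?A) * (L2_set y S)\<^sup>2"
    using gy by (simp add: L2_set_def sum_nonneg sum_distrib_left power2_eq_square mult.left_commute)
  ultimately show "\<exists>v. (\<forall>i. i \<notin> S \<longrightarrow> v i = 0) \<and> L2_set v S \<noteq> 0 \<and> form v v = (Lambda_min Q p \<psi> S)\<^sup>2 * (L2_set v S)\<^sup>2"
    unfolding Lam using y(1) by blast
qed

text \<open>A lowest eigenvector of the block on \<open>S\<close>, extended by 0, belongs to R(S,S)
  and is therefore a competitor in the infimum.\<close>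

lemma restricted_eigenvalue_le_Lambda_min:
  assumes S: "S \<subseteq> {..<p}" "S \<noteq> {}" and pos: "0 < min_eigenvalue (block11 \<Sigma> S)" and "card S \<le> L"
  shows "restricted_eigenvalue Q p \<psi> S L \<le> Lambda_min Q p \<psi> S" "0 \<le> restricted_eigenvalue Q p \<psi> S L"
proof -
  obtain v where v: "\<And>i. i \<notin> S \<Longrightarrow> v i = 0" "L2_set v S \<noteq> 0"
    "form v v = (Lambda_min Q p \<psi> S)\<^sup>2 * (L2_set v S)\<^sup>2"
    using Lambda_min_bounds(2)[OF S pos] by blast
  have "\<exists>i\<in>S. v i \<noteq> 0"
  proof (rule ccontr)
    assume "\<not> ?thesis"
    then show False using v(2) by (simp add: L2_set_def)
  qed
  moreover have "(\<Sum>i\<in>{..<p} - S. \<bar>v i\<bar>) \<le> (\<Sum>i\<in>S. \<bar>v i\<bar>)" using v(1) by (simp add: sum_nonneg)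
  ultimately have *: "(restricted_eigenvalue Q p \<psi> S L)\<^sup>2 * (L2_set v S)\<^sup>2 \<le> form v v"
    "0 \<le> restricted_eigenvalue Q p \<psi> S L"
    using S(1) assms(4) by (auto intro!: restricted_eigenvalue_le[of S S L v])
  then show "0 \<le> restricted_eigenvalue Q p \<psi> S L" by simp
  have "0 < (L2_set v S)\<^sup>2" using v(2) by simp
  then have "(restricted_eigenvalue Q p \<psi> S L)\<^sup>2 \<le> (Lambda_min Q p \<psi> S)\<^sup>2"
    using *(1) unfolding v(3) by simp
  moreover have "0 \<le> Lambda_min Q p \<psi> S" using pos by (simp add: Lambda_min_def)
  ultimately show "restricted_eigenvalue Q p \<psi> S L \<le> Lambda_min Q p \<psi> S" by (rule power2_le_imp_le)
qed

text \<open>The sign vector will be supplied as the gradient of a vector \<open>w\<close> supported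
  in \<open>N\<close>. Inverting the square block then recovers \<open>w\<close>, and the lower
  block maps it to its gradient off \<open>N\<close>.\<close>

lemma block_inverse_certificate:
  assumes N: "N \<subseteq> {..<p}" and w: "\<forall>j. j \<notin> N \<longrightarrow> w j = 0"
    and inj: "\<forall>v. (\<forall>j. j \<notin> N \<longrightarrow> v j = 0) \<longrightarrow> (\<forall>j\<in>N. grad v j = 0) \<longrightarrow> v = (\<lambda>_. 0)"
    and out: "\<forall>j\<in>{..<p} - N. \<bar>grad w j\<bar> \<le> 1"
  shows "invertible_mat (block11 \<Sigma> N)"
    and "linf_norm ((block21 \<Sigma> N * the (mat_inverse (block11 \<Sigma> N))) *\<^sub>v sub_vec N (grad w)) \<le> 1"
proof -
  let ?A = "block11 \<Sigma> N" and ?C = "block21 \<Sigma> N"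
  have fN: "finite N" using N finite_subset by blast
  have A: "?A \<in> carrier_mat (card N) (card N)" using N by (rule block11_carrier)
  have C: "?C \<in> carrier_mat (dim_row ?C) (card N)"
    using N by (simp add: block21_def submatrix_def gram_mat_def Collect_conj_eq inf.absorb2 flip: lessThan_def)
  have zero: "0\<^sub>v (card N) = sub_vec N (\<lambda>_. 0)" by (auto simp: sub_vec_def)
  have mult: "?A *\<^sub>v sub_vec N v = sub_vec N (grad v)" if "\<forall>i. i \<notin> N \<longrightarrow> v i = 0" for v
    unfolding block11_def using N that by (intro submatrix_gram_mult_sub_vec) auto
  have "det ?A \<noteq> 0"
  proof
    assume "det ?A = 0"
    then obtain x where x: "x \<in> carrier_vec (card N)" "x \<noteq> 0\<^sub>v (card N)" "?A *\<^sub>v x = 0\<^sub>v (card N)"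
      unfolding det_0_iff_vec_prod_zero_field[OF A] by blast
    obtain y where y: "\<forall>j. j \<notin> N \<longrightarrow> y j = 0" "x = sub_vec N y" using sub_vec_surj[OF x(1) fN] by blast
    have "\<forall>i\<in>N. grad y i = 0"
      using x(3) unfolding y(2) mult[OF y(1)] zero sub_vec_eq_iff[OF fN] .
    then have "y = (\<lambda>_. 0)" using y(1) inj by blast
    then show False using x(2) unfolding y(2) zero by simp
  qed
  then have unit: "?A \<in> Units (ring_mat TYPE(real) (card N) ())" using A by (rule det_non_zero_imp_unit[rotated])
  then obtain B where B: "mat_inverse ?A = Some B"
    using mat_inverse(1)[OF A, of "()"] by (cases "mat_inverse ?A") auto
  note AB = mat_inverse(2)[OF A B]
  then show "invertible_mat ?A"
    unfolding invertible_mat_def inverts_mat_def using A by (intro conjI exI[of _ B]) auto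
  have sw: "sub_vec N w \<in> carrier_vec (card N)" by (simp add: sub_vec_def)
  have "(?C * B) *\<^sub>v sub_vec N (grad w) = ?C *\<^sub>v (B *\<^sub>v (?A *\<^sub>v sub_vec N w))"
    unfolding mult[OF w] using AB C by (intro assoc_mult_mat_vec) (auto simp: sub_vec_def)
  also have "B *\<^sub>v (?A *\<^sub>v sub_vec N w) = (B * ?A) *\<^sub>v sub_vec N w"
    using AB A sw by (intro assoc_mult_mat_vec[symmetric]) auto
  also have "\<dots> = sub_vec N w" using AB sw by simp
  also have "?C *\<^sub>v sub_vec N w = sub_vec ({..<p} - N) (grad w)"
    unfolding block21_def using N w by (subst submatrix_gram_mult_sub_vec) (auto simp: gram_mat_def)
  finally have eq: "(?C * the (mat_inverse ?A)) *\<^sub>v sub_vec N (grad w) = sub_vec ({..<p} - N) (grad w)"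
    by (simp add: B)
  show "linf_norm ((?C * the (mat_inverse ?A)) *\<^sub>v sub_vec N (grad w)) \<le> 1"
    unfolding eq linf_norm_def
  proof (subst Max_le_iff)
    show "\<forall>a\<in>insert 0 ((\<lambda>j. \<bar>sub_vec ({..<p} - N) (grad w) $ j\<bar>) ` {..<dim_vec (sub_vec ({..<p} - N) (grad w))}). a \<le> 1"
      using out pick_in_set_le[of _ "{..<p} - N"] by (auto simp: sub_vec_def)
  qed auto
qed

section \<open>The sign condition under alpha(S) < 1\<close>

lemma weak_irrepresentable_of_alpha:
  assumes S: "S \<subseteq> {..<p}" "S \<noteq> {}" and pos: "0 < min_eigenvalue (block11 \<Sigma> S)" and alpha: "alpha Q p \<psi> S < 1"
  shows "weak_irrepresentable \<Sigma> S (2 * card S)"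
  unfolding weak_irrepresentable_def
proof
  fix \<tau> assume \<tau>: "\<tau> \<in> S \<rightarrow>\<^sub>E {- 1, 1 :: real}"
  define \<theta> where "\<theta> = restricted_orthogonality Q p \<psi> S (card S)"
  define \<delta> where "\<delta> = restricted_isometry Q p \<psi> (card S)"
  define \<phi> where "\<phi> = restricted_eigenvalue Q p \<psi> S (2 * card S)"
  define \<Lambda> where "\<Lambda> = Lambda_min Q p \<psi> S"
  have fS: "finite S" using S finite_subset by blast
  have sp: "0 < card S" "0 < p" using S fS by (auto simp: card_gt_0_iff)
  \<comment> \<open>A bound below 1 rules out the value \<infinity>, and with it
    \<open>\<phi> = 0\<close>.\<close>
  have "\<phi> \<noteq> 0" and small: "(sqrt 2 * \<theta> + sqrt ((1 + \<delta>) * \<theta>)) / (\<phi> * \<Lambda>) < 1"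
    using alpha by (auto simp: alpha_def Let_def \<theta>_def \<delta>_def \<phi>_def \<Lambda>_def split: if_splits)
  moreover have \<phi>\<Lambda>: "\<phi> \<le> \<Lambda>" "0 \<le> \<phi>"
    using restricted_eigenvalue_le_Lambda_min[OF S pos, of "2 * card S"] by (simp_all add: \<phi>_def \<Lambda>_def)
  ultimately have \<phi>: "0 < \<phi>" by simp
  have \<Lambda>: "0 < \<Lambda>" using pos by (simp add: \<Lambda>_def Lambda_min_def)
  have \<theta>: "0 \<le> \<theta>"
    unfolding \<theta>_def by (rule restricted_orthogonality_bound(2)[of S "\<lambda>_. 0" "{}" "\<lambda>_. 0"]) (use S in auto)
  have "sqrt 2 * \<theta> + sqrt ((1 + \<delta>) * \<theta>) < \<phi> * \<Lambda>"
    using small \<phi> \<Lambda> by (simp add: divide_less_eq)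
  moreover have "1 * \<theta> \<le> sqrt 2 * \<theta>" using \<theta> by (intro mult_right_mono) auto
  ultimately have small: "\<theta> + sqrt ((1 + \<delta>) * \<theta>) < \<phi> * \<Lambda>" by simp
  have phi: "\<phi>\<^sup>2 * (L2_set w N)\<^sup>2 \<le> form w w"
    if "S \<subseteq> N" "N \<subseteq> {..<p}" "card N \<le> 2 * card S"
      "(\<Sum>i\<in>{..<p} - S. \<bar>w i\<bar>) \<le> (\<Sum>i\<in>S. \<bar>w i\<bar>)" "\<exists>i\<in>S. w i \<noteq> 0"
      "\<And>i j. i \<in> {..<p} - N \<Longrightarrow> j \<in> N - S \<Longrightarrow> \<bar>w i\<bar> \<le> \<bar>w j\<bar>" for N w
    unfolding \<phi>_def using that by (rule restricted_eigenvalue_le(1))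
  have \<tau>1: "\<bar>\<tau> i\<bar> = 1" if "i \<in> S" for i using \<tau> that by (auto dest!: PiE_mem)
  have cone: "\<phi>\<^sup>2 * (\<Sum>i\<in>S. (w i)\<^sup>2) \<le> form w w" if "(\<Sum>i\<in>{..<p} - S. \<bar>w i\<bar>) \<le> (\<Sum>i\<in>S. \<bar>w i\<bar>)" for w
  proof (cases "\<exists>i\<in>S. w i \<noteq> 0")
    case True
    then show ?thesis using phi[of S w] S that by (simp add: L2_set_def sum_nonneg)
  qed (simp add: form_nonneg)
  have "\<exists>u. minimizer S \<tau> {..<p} u \<and>
      (\<forall>v. (\<forall>i. i \<notin> S \<union> {i \<in> {..<p} - S. u i \<noteq> 0} \<longrightarrow> v i = 0) \<longrightarrow>
         (\<forall>i \<in> S \<union> {i \<in> {..<p} - S. u i \<noteq> 0}. grad v i = 0) \<longrightarrow> v = (\<lambda>_. 0))"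
  proof (rule sparse_minimizer_exists[OF S])
    show "\<bar>\<tau> i\<bar> \<le> 1" if "i \<in> S" for i using \<tau>1[OF that] by simp
    show "0 < \<phi>\<^sup>2" using \<phi> by simp
  qed (rule cone)
  then obtain u where u: "minimizer S \<tau> {..<p} u"
    and inj: "\<forall>v. (\<forall>i. i \<notin> S \<union> {i \<in> {..<p} - S. u i \<noteq> 0} \<longrightarrow> v i = 0) \<longrightarrow>
         (\<forall>i \<in> S \<union> {i \<in> {..<p} - S. u i \<noteq> 0}. grad v i = 0) \<longrightarrow> v = (\<lambda>_. 0)"
    by (elim exE conjE)
  define T where "T = {i \<in> {..<p} - S. u i \<noteq> 0}"
  define N where "N = S \<union> T"
  have "card T < card S"
    unfolding T_def
  proof (rule active_set_card_less[OF S _ u \<Lambda> \<phi> \<phi>\<Lambda>(1) \<theta>])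
    show "\<phi>\<^sup>2 * (L2_set w N)\<^sup>2 \<le> form w w"
      if "S \<subseteq> N" "N \<subseteq> {..<p}" "card N \<le> 2 * card S"
        "(\<Sum>i\<in>{..<p} - S. \<bar>w i\<bar>) \<le> (\<Sum>i\<in>S. \<bar>w i\<bar>)" "\<exists>i\<in>S. w i \<noteq> 0"
        "\<And>i j. i \<in> {..<p} - N \<Longrightarrow> j \<in> N - S \<Longrightarrow> \<bar>w i\<bar> \<le> \<bar>w j\<bar>" for N w
      using that by (rule phi)
    show "\<Lambda>\<^sup>2 * (L2_set w S)\<^sup>2 \<le> form w w" if "\<And>i. i \<notin> S \<Longrightarrow> w i = 0" for w
      unfolding \<Lambda>_def using that by (rule Lambda_min_bounds(1)[OF S pos])
    show "\<bar>form w z\<bar> \<le> \<theta> * L2_set w S * L2_set z M"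
      if "\<And>i. i \<notin> S \<Longrightarrow> w i = 0" "\<And>i. i \<notin> M \<Longrightarrow> z i = 0" "M \<subseteq> {..<p} - S" "card M \<le> card S" for w z M
      unfolding \<theta>_def using S(1) that by (rule restricted_orthogonality_bound(1))
    show "form z z \<le> (1 + \<delta>) * (L2_set z M)\<^sup>2"
      if "\<And>i. i \<notin> M \<Longrightarrow> z i = 0" "M \<subseteq> {..<p} - S" "card M \<le> card S" for z M
      unfolding \<delta>_def using that sp by (intro restricted_isometry_bound) auto
  qed (fact \<tau>1 small)+
  then have cN: "card N \<le> 2 * card S" using card_Un_le[of S T] by (simp add: N_def)
  have N: "S \<subseteq> N" "N \<subseteq> {..<p}" using S by (auto simp: N_def T_def)
  \<comment> \<open>On \<open>N\<close> the gradient of \<open>u\<close> is minus the sign vector,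
    so the negated minimiser is the preimage of the signs under the Gram block.\<close>
  define w where "w = (\<lambda>i. (- 1) * u i)"
  have gw: "grad w i = - grad u i" for i unfolding w_def grad_scale by simp
  define \<tau>' where "\<tau>' = restrict (\<lambda>i. sgn (u i)) (N - S)"
  have gT: "grad u i = - sgn (u i)" if "i \<in> N - S" for i
    using minimizer_grad_outside(2)[OF u S(1) subset_refl, of i] that by (auto simp: N_def T_def)
  have \<tau>': "\<tau>' \<in> (N - S) \<rightarrow>\<^sub>E {- 1, 1}" by (auto simp: \<tau>'_def N_def T_def sgn_if)
  have signs: "sub_vec N (\<lambda>j. if j \<in> S then \<tau> j else \<tau>' j) = sub_vec N (grad w)"
    using minimizer_grad_inside[OF u S(1) subset_refl] gT N finite_subset[OF N(2)]
    by (subst sub_vec_eq_iff) (auto simp: gw \<tau>'_def)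
  have w0: "\<forall>j. j \<notin> N \<longrightarrow> w j = 0"
    using u by (auto simp: w_def N_def T_def minimizer_def)
  have out: "\<forall>j\<in>{..<p} - N. \<bar>grad w j\<bar> \<le> 1"
    using minimizer_grad_outside(1)[OF u S(1) subset_refl] N by (auto simp: gw)
  note cert = block_inverse_certificate[OF N(2) w0 inj[folded T_def, folded N_def] out]
  have dim: "dim_row \<Sigma> = p" by (simp add: gram_mat_def)
  show "\<exists>N. S \<subseteq> N \<and> N \<subseteq> {..<dim_row \<Sigma>} \<and> card N \<le> 2 * card S \<and> invertible_mat (block11 \<Sigma> N) \<and>
        (\<exists>\<tau>' \<in> (N - S) \<rightarrow>\<^sub>E {- 1, 1 :: real}.
           linf_norm ((block21 \<Sigma> N * the (mat_inverse (block11 \<Sigma> N))) *\<^sub>v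
             sub_vec N (\<lambda>j. if j \<in> S then \<tau> j else \<tau>' j)) \<le> 1)"
    unfolding dim
  proof (intro exI conjI)
    show "\<exists>\<tau>'\<in>(N - S) \<rightarrow>\<^sub>E {- 1, 1 :: real}.
        linf_norm ((block21 \<Sigma> N * the (mat_inverse (block11 \<Sigma> N))) *\<^sub>v
          sub_vec N (\<lambda>j. if j \<in> S then \<tau> j else \<tau>' j)) \<le> 1"
      using cert(2) unfolding signs[symmetric] by (rule bexI[OF _ \<tau>'])
  qed (fact N cN cert(1))+
qed

end

theorem theorem8p1:
  fixes Q :: "'a measure" and p :: nat and \<psi> :: "nat \<Rightarrow> 'a \<Rightarrow> real" and S :: "nat set"
  assumes "prob_space Q"
    and "\<And>j. j < p \<Longrightarrow> in_L2 Q (\<psi> j)"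
    and "S \<subseteq> {..<p}" and "S \<noteq> {}"
    and "min_eigenvalue (block11 (gram_mat Q p \<psi>) S) > 0"
    and "alpha Q p \<psi> S < 1"
  shows "weak_irrepresentable (gram_mat Q p \<psi>) S (2 * card S)"
proof -
  interpret L2_family Q p \<psi>
    using assms(2) by (rule L2_family.intro)
  show ?thesis
    by (rule weak_irrepresentable_of_alpha[OF assms(3-6)])
qed

end
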